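(* For every integer $k\ge 2$ there exist $\varepsilon_0>0$, a family of smooth bounded domains $\Omega_{\varepsilon,k}\subset\mathbb{R}^2$ and a family of smooth functions $u_{\varepsilon,k}:\Omega_{\varepsilon,k}\to(0,\infty)$, indexed by $\varepsilon\in(0,\varepsilon_0)$, such that each $u_{\varepsilon,k}$ solves the torsion problem $$-\Delta u_{\varepsilon,k}=1\ \text{ in }\Omega_{\varepsilon,k},\qquad u_{\varepsilon,k}=0\ \text{ on }\partial\Omega_{\varepsilon,k},$$ and the following hold. (P0) For every $\varepsilon\in(0,\varepsilon_0)$, $\Omega_{\varepsilon,k}$ is starshaped with respect to one of its interior points. (P1) For every $\varepsilon\in(0,\varepsilon_0)$ there is $c\in\mathbb{R}$ such that the superlevel set $\{u_{\varepsilon,k}>c\}$ is non-empty and has at least $k$ connected components; in particular $u_{\varepsilon,k}$ has at least $k$ maximum points. (P2) Let $S=\{(x,y)\in\mathbb{R}^2: |y|<1\}$. For every compact set $Q\subset\mathbb{R}^2$, $\Omega_{\varepsilon,k}\cap Q\to S\cap Q$ as $\varepsilon\to0$. (P3) For every $\varepsilon\in(0,\varepsilon_0)$ the curvature of $\partial\Omega_{\varepsilon,k}$ changes sign and vanishes at exactly two points of $\partial\Omega_{\varepsilon,k}$. Moreover $\min_{\partial\Omega_{\varepsilon,k}}\mathrm{Curv}_{\partial\Omega_{\varepsilon,k}}\to0$ as $\varepsilon\to0$.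
   Context: A domain is a connected open set. "Maximum points" are local maximum points. A set $\Omega$ is starshaped with respect to $p\in\Omega$ if for every $q\in\Omega$ the segment from $p$ to $q$ lies in $\Omega$. $\mathrm{Curv}_{\partial\Omega}$ is the oriented curvature of the boundary curve, with the sign convention that it is nonnegative when $\Omega$ is convex. When $\partial\Omega$ is a regular level curve $\{u=0\}$ of a function $u$ that is positive in $\Omega$ and smooth up to the boundary, $$\mathrm{Curv}_{\partial\Omega}=-\frac{u_{xx}u_y^2-2u_{xy}u_xu_y+u_{yy}u_x^2}{(u_x^2+u_y^2)^{3/2}}.$$ The convergence $\Omega_{\varepsilon,k}\cap Q\to S\cap Q$ as $\varepsilon\to 0$ means: for every $\delta\in(0,1)$ one has, for all sufficiently small $\varepsilon$ (depending on $\delta$ and $Q$), $$\{|y|<1-\delta\}\cap Q\subset\Omega_{\varepsilon,k}\cap Q\subset\{|y|<1+\delta\}\cap Q.$$ *)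

theory Defs
  imports "HOL-Analysis.Analysis"
begin

text \<open>Points of the plane are pairs \<open>(x, y) :: real \<times> real\<close>. All functions on open sets are
  represented by total functions, of which only the values on the set in question matter.\<close>

fun higher_differentiable_on ::
  "'a::real_normed_vector set \<Rightarrow> ('a \<Rightarrow> 'b::real_normed_vector) \<Rightarrow> nat \<Rightarrow> bool" where
  "higher_differentiable_on S f 0 \<longleftrightarrow> continuous_on S f"
| "higher_differentiable_on S f (Suc n) \<longleftrightarrow>
     (\<forall>x\<in>S. f differentiable (at x)) \<and>
     (\<forall>v. higher_differentiable_on S (\<lambda>x. frechet_derivative f (at x) v) n)"

text \<open>\<open>C\<^sup>\<infinity>\<close> on a set; only meant for open sets, as the derivatives are full derivatives.\<close>

definition smooth_on :: "'a::real_normed_vector set \<Rightarrow> ('a \<Rightarrow> 'b::real_normed_vector) \<Rightarrow> bool" where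
  "smooth_on S f \<longleftrightarrow> (\<forall>n. higher_differentiable_on S f n)"

definition laplacian :: "('a::euclidean_space \<Rightarrow> real) \<Rightarrow> 'a \<Rightarrow> real" where
  "laplacian f x =
     (\<Sum>b\<in>Basis. frechet_derivative (\<lambda>z. frechet_derivative f (at z) b) (at x) b)"

definition domain :: "'a::topological_space set \<Rightarrow> bool" where
  "domain \<Omega> \<longleftrightarrow> open \<Omega> \<and> connected \<Omega>"

text \<open>Near each boundary point the set is \<open>{\<phi> > 0}\<close> and its boundary is \<open>{\<phi> = 0}\<close>, for some smooth
  \<open>\<phi>\<close> without critical points. In particular the set lies locally on one side of its boundary.\<close>

definition smooth_boundary :: "'a::euclidean_space set \<Rightarrow> bool" where
  "smooth_boundary \<Omega> \<longleftrightarrow>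
     (\<forall>p\<in>frontier \<Omega>. \<exists>U (\<phi> :: 'a \<Rightarrow> real). open U \<and> p \<in> U \<and> smooth_on U \<phi> \<and>
        (\<forall>q\<in>U. frechet_derivative \<phi> (at q) \<noteq> (\<lambda>v. 0)) \<and>
        \<Omega> \<inter> U = {q\<in>U. \<phi> q > 0} \<and> frontier \<Omega> \<inter> U = {q\<in>U. \<phi> q = 0})"

definition rot90 :: "real \<times> real \<Rightarrow> real \<times> real" where
  "rot90 v = (- snd v, fst v)"

definition cross :: "real \<times> real \<Rightarrow> real \<times> real \<Rightarrow> real" where
  "cross v w = fst v * snd w - snd v * fst w"

text \<open>Let \<open>\<gamma>\<close> be a regular \<open>C\<^sup>2\<close> parametrization of the boundary near \<open>p\<close> which keeps \<open>\<Omega>\<close> on its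
  left, i.e. the left normal \<open>rot90 (\<gamma>' 0)\<close> points into \<open>\<Omega>\<close>. The oriented curvature at \<open>p\<close> is then
  \<open>cross \<gamma>' \<gamma>'' / \<bar>\<gamma>'\<bar>\<^sup>3\<close>. With this orientation it is nonnegative for convex \<open>\<Omega>\<close> (the unit disc
  has curvature \<open>1\<close>), and if \<open>\<partial>\<Omega>\<close> is a regular level curve \<open>{u = 0}\<close> with \<open>u > 0\<close> in \<open>\<Omega>\<close> it equals
  \<open>- (u\<^sub>x\<^sub>x u\<^sub>y\<^sup>2 - 2 u\<^sub>x\<^sub>y u\<^sub>x u\<^sub>y + u\<^sub>y\<^sub>y u\<^sub>x\<^sup>2) / \<bar>\<nabla>u\<bar>\<^sup>3\<close>: differentiate \<open>u (\<gamma> t) = 0\<close> twice and use that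
  \<open>\<nabla>u\<close> is a positive multiple of \<open>rot90 \<gamma>'\<close>.\<close>

definition has_boundary_curvature :: "(real \<times> real) set \<Rightarrow> real \<times> real \<Rightarrow> real \<Rightarrow> bool" where
  "has_boundary_curvature \<Omega> p \<kappa> \<longleftrightarrow>
     (\<exists>r>0. \<exists>\<gamma> \<gamma>' \<gamma>'' :: real \<Rightarrow> real \<times> real.
        (\<forall>t\<in>{-r<..<r}. (\<gamma> has_vector_derivative \<gamma>' t) (at t) \<and>
                        (\<gamma>' has_vector_derivative \<gamma>'' t) (at t) \<and>
                        \<gamma>' t \<noteq> 0 \<and> \<gamma> t \<in> frontier \<Omega>) \<and>
        continuous_on {-r<..<r} \<gamma>'' \<and>
        \<gamma> 0 = p \<and>
        (\<forall>\<^sub>F s in at_right 0. p + s *\<^sub>R rot90 (\<gamma>' 0) \<in> \<Omega>) \<and>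
        \<kappa> = cross (\<gamma>' 0) (\<gamma>'' 0) / norm (\<gamma>' 0) ^ 3)"

text \<open>Well defined when \<open>smooth_boundary \<Omega>\<close> holds and \<open>p \<in> frontier \<Omega>\<close>.\<close>

definition Curv :: "(real \<times> real) set \<Rightarrow> real \<times> real \<Rightarrow> real" where
  "Curv \<Omega> p = (THE \<kappa>. has_boundary_curvature \<Omega> p \<kappa>)"

text \<open>A smooth positive solution of \<open>-\<Delta>u = 1\<close> in \<open>\<Omega>\<close>, \<open>u = 0\<close> on \<open>\<partial>\<Omega>\<close>; the boundary values
  are attained continuously.\<close>

definition torsion_solution :: "'a::euclidean_space set \<Rightarrow> ('a \<Rightarrow> real) \<Rightarrow> bool" where
  "torsion_solution \<Omega> u \<longleftrightarrow>
     smooth_on \<Omega> u \<and> continuous_on (closure \<Omega>) u \<and>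
     (\<forall>x\<in>\<Omega>. u x > 0) \<and> (\<forall>x\<in>\<Omega>. - laplacian u x = 1) \<and> (\<forall>x\<in>frontier \<Omega>. u x = 0)"

definition max_points :: "'a::topological_space set \<Rightarrow> ('a \<Rightarrow> real) \<Rightarrow> 'a set" where
  "max_points \<Omega> u = {p\<in>\<Omega>. \<forall>\<^sub>F q in nhds p. q \<in> \<Omega> \<longrightarrow> u q \<le> u p}"

text \<open>The set may be infinite, so \<open>card\<close> alone would not do.\<close>

definition at_least :: "nat \<Rightarrow> 'a set \<Rightarrow> bool" where
  "at_least k A \<longleftrightarrow> (\<exists>B\<subseteq>A. finite B \<and> card B = k)"

end

theory Submission
  imports Defs
begin

text \<open>Perturb the solution \<open>(1 - y\<^sup>2) / 2\<close> on the strip by \<open>\<epsilon> v\<close>, where the harmonic function \<open>v\<close> is the sum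
  of three parts: \<open>cos x cosh y\<close> creates the \<open>k\<close> bumps on the axis \<open>y = 0\<close>, the quartic
  \<open>- a Re (x + i y)\<^sup>4\<close> makes the component of \<open>{u > 0}\<close> bounded, and the tilt \<open>m (3 x\<^sup>2 y - y\<^sup>3)\<close>, which
  vanishes on the axis, breaks the symmetry \<open>y \<rightarrow> - y\<close>. To leading order in \<open>\<epsilon>\<close> the curvature is
  \<open>- \<epsilon> v\<^sub>x\<^sub>x (x, \<plusminus> 1)\<close>. For large \<open>m\<close> this is positive on the whole lower boundary, while on the upper
  one it is negative for small \<open>\<bar>x\<bar>\<close> and then increases in \<open>\<bar>x\<bar>\<close>: this gives exactly two inflection
  points. Starshapedness with respect to the origin holds because
  \<open>r \<cdot> \<nabla>u < 2 u\<close> in the strip \<open>\<bar>y\<bar> \<le> 2\<close>, so that \<open>u (t p) / t\<^sup>2\<close> decreases in \<open>t\<close>.\<close>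

section \<open>Functions generated by polynomials and (hyperbolic) sines and cosines\<close>

text \<open>The boundary reaches out to |x| of order (e a)^(-1/4), so an expansion in e is not
  uniform along it. Hence the split at an L1 independent of e: inside, the expansion is controlled
  by bounds on a fixed box; outside, the curvature numerator is treated as a quadratic form in the
  gradient, positive because v_yy grows like x^2 while v_xy is O(x). Without the tilt the lower arc
  would mirror the upper one and there would be four inflections. The tilt enters v_yy only as -6 m
  y, which does not depend on x. So the place L0 from which v_yy increases in x is fixed by the
  quartic alone, and m is chosen afterwards, large enough for the upper arc up to L0. The order of
  choice is k, a, L0, m, L1, the bounds on v, and then the range of e. The level separating the
  bumps is 1/2, the maximum of the unperturbed profile, so that the sign of v decides near the axis.
  As u becomes positive again far away outside the strip |y| < 2, the domain is cut there; the
  single bound e K <= 1/4 gives u < 0 on the cut, starshapedness and a nonzero gradient on the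
  boundary.\<close>

inductive_set analytic_expr :: "(real \<times> real \<Rightarrow> real) set" where
  const: "(\<lambda>p. c) \<in> analytic_expr"
| fst: "(\<lambda>p. fst p) \<in> analytic_expr"
| snd: "(\<lambda>p. snd p) \<in> analytic_expr"
| sin: "(\<lambda>p. sin (fst p)) \<in> analytic_expr"
| cos: "(\<lambda>p. cos (fst p)) \<in> analytic_expr"
| sinh: "(\<lambda>p. sinh (snd p)) \<in> analytic_expr"
| cosh: "(\<lambda>p. cosh (snd p)) \<in> analytic_expr"
| add: "f \<in> analytic_expr \<Longrightarrow> g \<in> analytic_expr \<Longrightarrow> (\<lambda>p. f p + g p) \<in> analytic_expr"
| mult: "f \<in> analytic_expr \<Longrightarrow> g \<in> analytic_expr \<Longrightarrow> (\<lambda>p. f p * g p) \<in> analytic_expr"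

lemma analytic_expr_minus: "f \<in> analytic_expr \<Longrightarrow> (\<lambda>p. - f p) \<in> analytic_expr"
  using analytic_expr.mult[OF analytic_expr.const[of "-1"], of f] by simp

lemma analytic_expr_diff:
  "f \<in> analytic_expr \<Longrightarrow> g \<in> analytic_expr \<Longrightarrow> (\<lambda>p. f p - g p) \<in> analytic_expr"
  using analytic_expr.add[OF _ analytic_expr_minus, of f g] by simp

lemma analytic_expr_power: "f \<in> analytic_expr \<Longrightarrow> (\<lambda>p. f p ^ n) \<in> analytic_expr"
  by (induction n) (auto intro: analytic_expr.intros)

lemmas analytic_expr_intros =
  analytic_expr.intros analytic_expr_minus analytic_expr_diff analytic_expr_power

text \<open>Keeping the partial derivatives as named functions lets second derivatives be stated by
  applying the notion again; a shared mixed partial then expresses the symmetry of the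
  Hessian.\<close>

definition has_gradient ::
  "(real \<times> real \<Rightarrow> real) \<Rightarrow> (real \<times> real \<Rightarrow> real) \<Rightarrow> (real \<times> real \<Rightarrow> real) \<Rightarrow> bool" where
  "has_gradient f fx fy \<longleftrightarrow> (\<forall>z. (f has_derivative (\<lambda>h. fst h * fx z + snd h * fy z)) (at z))"

lemma has_gradientD:
  "has_gradient f fx fy \<Longrightarrow> (f has_derivative (\<lambda>h. fst h * fx z + snd h * fy z)) (at z)"
  unfolding has_gradient_def by (rule spec)

lemma has_gradient_compose_line:
  assumes "has_gradient f fx fy" "(\<gamma> has_vector_derivative d) (at t within S)"
  shows "((\<lambda>t. f (\<gamma> t)) has_real_derivative fst d * fx (\<gamma> t) + snd d * fy (\<gamma> t)) (at t within S)"
  using has_derivative_compose[OF assms(2)[unfolded has_vector_derivative_def]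
      has_gradientD[OF assms(1), of "\<gamma> t"]]
  unfolding has_field_derivative_def
  by (rule has_derivative_eq_rhs) (auto simp: fun_eq_iff algebra_simps)

lemma has_derivative_sinh_snd:
  "((\<lambda>p. sinh (snd p)) has_derivative (\<lambda>h. snd h * cosh (snd z))) (at (z :: real \<times> real))"
  using DERIV_compose_FDERIV[OF has_field_derivative_sinh[OF DERIV_ident]
      has_derivative_snd[OF has_derivative_ident], of z UNIV]
  by simp

lemma has_derivative_cosh_snd:
  "((\<lambda>p. cosh (snd p)) has_derivative (\<lambda>h. snd h * sinh (snd z))) (at (z :: real \<times> real))"
  using DERIV_compose_FDERIV[OF has_field_derivative_cosh[OF DERIV_ident]
      has_derivative_snd[OF has_derivative_ident], of z UNIV]
  by simp

text \<open>Closure under partial derivatives is the purpose of the class: smoothness of every order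
  follows by induction on the order, and Lipschitz bounds on compact convex sets follow from
  boundedness of the partials.\<close>

lemma analytic_expr_has_gradient:
  assumes "f \<in> analytic_expr"
  shows "\<exists>fx\<in>analytic_expr. \<exists>fy\<in>analytic_expr. has_gradient f fx fy"
  using assms
proof induction
  case (const c)
  show ?case
    by (rule bexI[of _ "\<lambda>_. 0"], rule bexI[of _ "\<lambda>_. 0"])
      (auto simp: has_gradient_def intro!: analytic_expr_intros)
next
  case fst
  show ?case
    by (rule bexI[of _ "\<lambda>_. 1"], rule bexI[of _ "\<lambda>_. 0"])
      (auto simp: has_gradient_def intro!: analytic_expr_intros derivative_eq_intros)
next
  case snd
  show ?case
    by (rule bexI[of _ "\<lambda>_. 0"], rule bexI[of _ "\<lambda>_. 1"])
      (auto simp: has_gradient_def intro!: analytic_expr_intros derivative_eq_intros)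
next
  case sin
  show ?case
    by (rule bexI[of _ "\<lambda>p. cos (fst p)"], rule bexI[of _ "\<lambda>_. 0"])
      (auto simp: has_gradient_def intro!: analytic_expr_intros derivative_eq_intros)
next
  case cos
  show ?case
    by (rule bexI[of _ "\<lambda>p. - sin (fst p)"], rule bexI[of _ "\<lambda>_. 0"])
      (auto simp: has_gradient_def intro!: analytic_expr_intros derivative_eq_intros)
next
  case sinh
  have "has_gradient (\<lambda>p. sinh (snd p)) (\<lambda>_. 0) (\<lambda>p. cosh (snd p))"
    by (simp add: has_gradient_def has_derivative_sinh_snd del: split_paired_All)
  then show ?case by (rule bexI[OF bexI[OF _ analytic_expr.cosh] analytic_expr.const])
next
  case cosh
  have "has_gradient (\<lambda>p. cosh (snd p)) (\<lambda>_. 0) (\<lambda>p. sinh (snd p))"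
    by (simp add: has_gradient_def has_derivative_cosh_snd del: split_paired_All)
  then show ?case by (rule bexI[OF bexI[OF _ analytic_expr.sinh] analytic_expr.const])
next
  case (add f g)
  then obtain fx fy gx gy where *:
    "fx \<in> analytic_expr" "fy \<in> analytic_expr" "gx \<in> analytic_expr" "gy \<in> analytic_expr"
    "has_gradient f fx fy" "has_gradient g gx gy" by blast
  show ?case
    by (rule bexI[of _ "\<lambda>p. fx p + gx p"], rule bexI[of _ "\<lambda>p. fy p + gy p"])
      (use * in \<open>auto simp: has_gradient_def algebra_simps
        intro!: analytic_expr_intros derivative_eq_intros\<close>)
next
  case (mult f g)
  then obtain fx fy gx gy where *:
    "fx \<in> analytic_expr" "fy \<in> analytic_expr" "gx \<in> analytic_expr" "gy \<in> analytic_expr"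
    "has_gradient f fx fy" "has_gradient g gx gy" by blast
  show ?case
    by (rule bexI[of _ "\<lambda>p. f p * gx p + fx p * g p"], rule bexI[of _ "\<lambda>p. f p * gy p + fy p * g p"])
      (use * mult.hyps in \<open>auto simp: has_gradient_def algebra_simps
        intro!: analytic_expr_intros derivative_eq_intros\<close>)
qed

lemma frechet_derivative_has_gradient:
  assumes "has_gradient f fx fy"
  shows "frechet_derivative f (at z) = (\<lambda>h. fst h * fx z + snd h * fy z)"
  using frechet_derivative_at[OF has_gradientD[OF assms], of z] by simp

lemma analytic_expr_continuous: "f \<in> analytic_expr \<Longrightarrow> continuous_on S f"
  by (induction rule: analytic_expr.induct) (auto intro!: continuous_intros)

lemma has_gradient_continuous: "has_gradient f fx fy \<Longrightarrow> continuous_on S f"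
  using has_derivative_continuous[OF has_gradientD] continuous_at_imp_continuous_on by blast

lemma analytic_expr_smooth: "f \<in> analytic_expr \<Longrightarrow> smooth_on S f"
proof -
  have "f \<in> analytic_expr \<Longrightarrow> higher_differentiable_on S f n" for n
  proof (induction n arbitrary: f)
    case 0
    then show ?case by (simp add: analytic_expr_continuous)
  next
    case (Suc n)
    obtain fx fy where *: "fx \<in> analytic_expr" "fy \<in> analytic_expr" "has_gradient f fx fy"
      using analytic_expr_has_gradient[OF Suc.prems] by blast
    have "f differentiable (at x)" for x
      using has_gradientD[OF *(3)] by (rule differentiableI)
    moreover have "(\<lambda>x. frechet_derivative f (at x) v) \<in> analytic_expr" for v
      unfolding frechet_derivative_has_gradient[OF *(3)] by (intro analytic_expr_intros *)
    ultimately show ?case using Suc.IH by simp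
  qed
  then show "f \<in> analytic_expr \<Longrightarrow> smooth_on S f" by (simp add: smooth_on_def)
qed

lemma has_gradient_laplacian:
  assumes "has_gradient f fx fy" "has_gradient fx fxx fxy" "has_gradient fy fyx fyy"
  shows "laplacian f z = fxx z + fyy z"
  by (simp add: laplacian_def Basis_prod_def frechet_derivative_has_gradient[OF assms(1)]
      frechet_derivative_has_gradient[OF assms(2)] frechet_derivative_has_gradient[OF assms(3)])

lemma analytic_expr_bounded:
  assumes "f \<in> analytic_expr" "compact S"
  shows "\<exists>C>0. \<forall>p\<in>S. \<bar>f p\<bar> \<le> C"
  using compact_imp_bounded[OF compact_continuous_image[OF analytic_expr_continuous[OF assms(1)] assms(2)]]
  unfolding bounded_pos by auto

text \<open>Mean value inequality along segments, hence the convexity. The distance is split by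
  coordinates because boundary points are later compared in x and y separately.\<close>

lemma analytic_expr_Lipschitz:
  assumes "f \<in> analytic_expr" "compact S" "convex S"
  shows "\<exists>C>0. \<forall>p\<in>S. \<forall>q\<in>S. \<bar>f p - f q\<bar> \<le> C * (\<bar>fst p - fst q\<bar> + \<bar>snd p - snd q\<bar>)"
proof -
  obtain fx fy where *: "fx \<in> analytic_expr" "fy \<in> analytic_expr" "has_gradient f fx fy"
    using analytic_expr_has_gradient[OF assms(1)] by blast
  obtain C1 where C1: "C1 > 0" "\<forall>p\<in>S. \<bar>fx p\<bar> \<le> C1"
    using analytic_expr_bounded[OF *(1) assms(2)] by blast
  obtain C2 where C2: "C2 > 0" "\<forall>p\<in>S. \<bar>fy p\<bar> \<le> C2"
    using analytic_expr_bounded[OF *(2) assms(2)] by blast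
  have "\<bar>f p - f q\<bar> \<le> (C1 + C2) * (\<bar>fst p - fst q\<bar> + \<bar>snd p - snd q\<bar>)" if "p \<in> S" "q \<in> S" for p q
  proof -
    have "norm (f p - f q) \<le> (C1 + C2) * norm (p - q)"
    proof (rule differentiable_bound[OF assms(3) _ _ that])
      fix x assume "x \<in> S"
      show "(f has_derivative (\<lambda>h. fst h * fx x + snd h * fy x)) (at x within S)"
        using has_gradientD[OF *(3)] by (rule has_derivative_at_withinI)
      show "onorm (\<lambda>h. fst h * fx x + snd h * fy x) \<le> C1 + C2"
      proof (rule onorm_le)
        fix h :: "real \<times> real"
        have "norm (fst h * fx x + snd h * fy x) \<le> norm (fst h) * \<bar>fx x\<bar> + norm (snd h) * \<bar>fy x\<bar>"
          by (metis norm_triangle_ineq norm_mult real_norm_def)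
        also have "\<dots> \<le> norm h * C1 + norm h * C2"
          using C1 C2 \<open>x \<in> S\<close> norm_fst_le[of "fst h" "snd h"] norm_snd_le[of "snd h" "fst h"]
          by (intro add_mono mult_mono) auto
        finally show "norm (fst h * fx x + snd h * fy x) \<le> (C1 + C2) * norm h"
          by (simp add: algebra_simps)
      qed
    qed
    also have "\<dots> \<le> (C1 + C2) * (\<bar>fst p - fst q\<bar> + \<bar>snd p - snd q\<bar>)"
      using norm_Pair_le[of "fst (p - q)" "snd (p - q)"] C1 C2
      unfolding prod.collapse by (intro mult_left_mono) auto
    finally show ?thesis by simp
  qed
  moreover have "C1 + C2 > 0" using C1(1) C2(1) by simp
  ultimately show ?thesis by blast
qed

section \<open>The curvature of a regular level curve\<close>

text \<open>\<open>U\<close> isolates one piece of the level set, since \<open>u\<close> may have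
  further zeros elsewhere. Continuity of the second partials is what makes boundary parametrizations
  of class C^2 available.\<close>

locale regular_level_set =
  fixes u ux uy uxx uxy uyy :: "real \<times> real \<Rightarrow> real" and \<Omega> U :: "(real \<times> real) set"
  assumes grad: "has_gradient u ux uy" "has_gradient ux uxx uxy" "has_gradient uy uxy uyy"
    and cont: "continuous_on UNIV uxx" "continuous_on UNIV uxy" "continuous_on UNIV uyy"
    and U: "open U"
    and \<Omega>: "\<Omega> = {q\<in>U. u q > 0}"
    and frontier: "frontier \<Omega> = {q\<in>U. u q = 0}"
    and regular: "q \<in> U \<Longrightarrow> u q = 0 \<Longrightarrow> (ux q, uy q) \<noteq> (0, 0)"
begin

definition curvature_numerator :: "real \<times> real \<Rightarrow> real" where
  "curvature_numerator q =
     - (uxx q * uy q ^ 2 - 2 * uxy q * ux q * uy q + uyy q * ux q ^ 2)"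

definition level_curvature :: "real \<times> real \<Rightarrow> real" where
  "level_curvature q = curvature_numerator q / norm (ux q, uy q) ^ 3"

text \<open>The first two derivatives of \<open>u\<close> along the curve vanish at 0, which gives
  the relations \<open>1\<close> and \<open>2\<close>. Eliminating the tangent in favour of the
  gradient turns the curvature of the curve into the level set formula.\<close>

lemma has_boundary_curvature_imp:
  assumes "has_boundary_curvature \<Omega> p \<kappa>"
  shows "\<kappa> = level_curvature p"
proof -
  obtain r \<gamma> \<gamma>' \<gamma>'' where r: "r > 0"
    and d1: "\<And>t. t \<in> {-r<..<r} \<Longrightarrow> (\<gamma> has_vector_derivative \<gamma>' t) (at t)"
    and d2: "\<And>t. t \<in> {-r<..<r} \<Longrightarrow> (\<gamma>' has_vector_derivative \<gamma>'' t) (at t)"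
    and nz: "\<And>t. t \<in> {-r<..<r} \<Longrightarrow> \<gamma>' t \<noteq> 0"
    and fr: "\<And>t. t \<in> {-r<..<r} \<Longrightarrow> \<gamma> t \<in> frontier \<Omega>"
    and p: "\<gamma> 0 = p"
    and inw: "\<forall>\<^sub>F s in at_right 0. p + s *\<^sub>R rot90 (\<gamma>' 0) \<in> \<Omega>"
    and \<kappa>: "\<kappa> = cross (\<gamma>' 0) (\<gamma>'' 0) / norm (\<gamma>' 0) ^ 3"
    using assms unfolding has_boundary_curvature_def by blast
  define w where "w t = fst (\<gamma>' t) * ux (\<gamma> t) + snd (\<gamma>' t) * uy (\<gamma> t)" for t
  have u0: "u (\<gamma> t) = 0" if "t \<in> {-r<..<r}" for t
    using fr[OF that] frontier by auto
  have w0: "w t = 0" if t: "t \<in> {-r<..<r}" for t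
  proof -
    have "((\<lambda>t. u (\<gamma> t)) has_real_derivative w t) (at t)"
      unfolding w_def by (rule has_gradient_compose_line[OF grad(1) d1[OF t]])
    moreover have "((\<lambda>t. u (\<gamma> t)) has_real_derivative 0) (at t)"
      by (rule has_field_derivative_transform_within_open[where f = "\<lambda>_. 0" and S = "{-r<..<r}"])
        (use t u0 in auto)
    ultimately show ?thesis by (rule DERIV_unique)
  qed
  obtain a b where ab: "\<gamma>' 0 = (a, b)" by fastforce
  obtain a2 b2 where ab2: "\<gamma>'' 0 = (a2, b2)" by fastforce
  define X Y A B C where "X = ux p" and "Y = uy p" and "A = uxx p" and "B = uxy p" and "C = uyy p"
  note defs = X_def Y_def A_def B_def C_def
  have mem0: "0 \<in> {-r<..<r}" using r by simp
  have 1: "a * X + b * Y = 0"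
    using w0[OF mem0] by (simp add: w_def ab p defs)
  have 2: "A * a\<^sup>2 + 2 * B * a * b + C * b\<^sup>2 + X * a2 + Y * b2 = 0"
  proof -
    have f1: "((\<lambda>t. fst (\<gamma>' t)) has_real_derivative a2) (at 0)"
      and f2: "((\<lambda>t. snd (\<gamma>' t)) has_real_derivative b2) (at 0)"
      using d2[OF mem0] ab2
      by (auto simp: has_real_derivative_iff_has_vector_derivative has_vector_derivative_def
          intro!: derivative_eq_intros)
    have "(w has_real_derivative
        (a * (a * A + b * B) + a2 * X) + (b * (a * B + b * C) + b2 * Y)) (at 0)"
      unfolding w_def
      using DERIV_add[OF DERIV_mult'[OF f1 has_gradient_compose_line[OF grad(2) d1[OF mem0]]]
          DERIV_mult'[OF f2 has_gradient_compose_line[OF grad(3) d1[OF mem0]]]]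
      by (simp add: ab p defs)
    moreover have "(w has_real_derivative 0) (at 0)"
      by (rule has_field_derivative_transform_within_open[where f = "\<lambda>_. 0" and S = "{-r<..<r}"])
        (use mem0 w0 in auto)
    ultimately have "(a * (a * A + b * B) + a2 * X) + (b * (a * B + b * C) + b2 * Y) = 0"
      by (rule DERIV_unique)
    then show ?thesis by (simp add: algebra_simps power2_eq_square)
  qed
  \<comment> \<open>\<open>d\<close> is the derivative of \<open>u\<close> along the left normal. As
    that normal points into the domain, \<open>d\<close> cannot be negative, and orthogonality of
    tangent and gradient makes it the product of their lengths.\<close>
  define d n where "d = a * Y - b * X" and "n = norm (a, b)"
  have n: "n > 0" "n\<^sup>2 = a\<^sup>2 + b\<^sup>2"
    using nz[OF mem0] ab by (auto simp: n_def norm_Pair zero_prod_def sum_power2_gt_zero_iff)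
  have pU: "p \<in> U" "u p = 0" using fr[OF mem0] p frontier by auto
  define g where "g = norm (X, Y)"
  have g: "g > 0" "g\<^sup>2 = X\<^sup>2 + Y\<^sup>2"
    using regular[OF pU] by (auto simp: g_def defs norm_Pair sum_power2_gt_zero_iff)
  have "d \<ge> 0"
  proof (rule ccontr)
    assume "\<not> d \<ge> 0"
    have "((\<lambda>s. p + s *\<^sub>R rot90 (\<gamma>' 0)) has_vector_derivative rot90 (\<gamma>' 0)) (at 0)"
      by (auto intro!: derivative_eq_intros)
    from has_gradient_compose_line[OF grad(1) this]
    have "((\<lambda>s. u (p + s *\<^sub>R rot90 (\<gamma>' 0))) has_real_derivative d) (at 0)"
      by (simp add: d_def ab rot90_def defs algebra_simps zero_prod_def[symmetric])
    from has_real_derivative_neg_dec_right[OF this] \<open>\<not> d \<ge> 0\<close>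
    obtain e where e: "e > 0" "\<And>h. h > 0 \<Longrightarrow> h < e \<Longrightarrow> u (p + h *\<^sub>R rot90 (\<gamma>' 0)) < u p"
      by auto
    obtain e' where e': "e' > 0" "\<And>h. h > 0 \<Longrightarrow> h < e' \<Longrightarrow> p + h *\<^sub>R rot90 (\<gamma>' 0) \<in> \<Omega>"
      using inw unfolding eventually_at_right_field by auto
    define h where "h = min e e' / 2"
    have "u (p + h *\<^sub>R rot90 (\<gamma>' 0)) < 0" "p + h *\<^sub>R rot90 (\<gamma>' 0) \<in> \<Omega>"
      using e(2)[of h] e'(2)[of h] e(1) e'(1) pU by (auto simp: h_def)
    then show False using \<Omega> by auto
  qed
  moreover have "d\<^sup>2 = (n * g)\<^sup>2"
  proof -
    have "d\<^sup>2 + (a * X + b * Y)\<^sup>2 = n\<^sup>2 * g\<^sup>2"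
      unfolding n(2) g(2) d_def by algebra
    then show ?thesis using 1 by (simp add: power_mult_distrib)
  qed
  moreover have "n * g \<ge> 0" using n(1) g(1) by simp
  ultimately have d: "d = n * g" by (metis power2_eq_imp_eq)
  \<comment> \<open>Coordinates of the gradient in the orthogonal frame of tangent and left normal;
    the tangential one vanishes by \<open>1\<close>.\<close>
  have "X * n\<^sup>2 = a * (a * X + b * Y) - b * d" "Y * n\<^sup>2 = b * (a * X + b * Y) + a * d"
    unfolding n(2) d_def by algebra+
  then have X: "X * n\<^sup>2 = - b * d" and Y: "Y * n\<^sup>2 = a * d"
    using 1 by simp_all
  have "d * (a * b2 - b * a2) = (- b * d) * a2 + (a * d) * b2" by algebra
  also have "\<dots> = n\<^sup>2 * (X * a2 + Y * b2)" unfolding X[symmetric] Y[symmetric] by algebra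
  also have "X * a2 + Y * b2 = - (A * a\<^sup>2 + 2 * B * a * b + C * b\<^sup>2)" using 2 by linarith
  finally have s1: "d * (a * b2 - b * a2) = n\<^sup>2 * - (A * a\<^sup>2 + 2 * B * a * b + C * b\<^sup>2)" .
  have s2: "d\<^sup>2 * (A * a\<^sup>2 + 2 * B * a * b + C * b\<^sup>2) = (n\<^sup>2)\<^sup>2 * (A * Y\<^sup>2 - 2 * B * X * Y + C * X\<^sup>2)"
  proof -
    have "d\<^sup>2 * (A * a\<^sup>2 + 2 * B * a * b + C * b\<^sup>2) = A * (a * d)\<^sup>2 - 2 * B * (- b * d) * (a * d) + C * (- b * d)\<^sup>2"
      by algebra
    also have "\<dots> = (n\<^sup>2)\<^sup>2 * (A * Y\<^sup>2 - 2 * B * X * Y + C * X\<^sup>2)"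
      unfolding X[symmetric] Y[symmetric] by algebra
    finally show ?thesis .
  qed
  have "g ^ 3 * (a * b2 - b * a2) * n ^ 3 = d\<^sup>2 * (d * (a * b2 - b * a2))"
    unfolding d by algebra
  also have "\<dots> = n\<^sup>2 * - (d\<^sup>2 * (A * a\<^sup>2 + 2 * B * a * b + C * b\<^sup>2))"
    unfolding s1 by algebra
  also have "\<dots> = n ^ 3 * - (A * Y\<^sup>2 - 2 * B * X * Y + C * X\<^sup>2) * n ^ 3"
    unfolding s2 by algebra
  finally have "g ^ 3 * (a * b2 - b * a2) * n ^ 3 = n ^ 3 * - (A * Y\<^sup>2 - 2 * B * X * Y + C * X\<^sup>2) * n ^ 3" .
  then have "g ^ 3 * (a * b2 - b * a2) = n ^ 3 * - (A * Y\<^sup>2 - 2 * B * X * Y + C * X\<^sup>2)"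
    using n(1) by simp
  then have "(a * b2 - b * a2) / n ^ 3 = - (A * Y\<^sup>2 - 2 * B * X * Y + C * X\<^sup>2) / g ^ 3"
    using n(1) g(1) by (simp add: frac_eq_eq mult.commute)
  then show ?thesis
    unfolding \<kappa> level_curvature_def curvature_numerator_def ab ab2 cross_def fst_conv snd_conv
      n_def g_def defs .
qed

text \<open>The inverse function theorem is applied to the map whose components are \<open>u\<close>
  and the position along the tangent at \<open>p\<close>; the curve is the preimage of a line on
  which the first component is 0. Its velocity solves a linear system and is thus an explicit
  function of the position (\<open>F1\<close>, \<open>F2\<close>), so the second derivative comes
  from the chain rule, with no higher regularity of the inverse map.\<close>

lemma has_boundary_curvature_exists:
  assumes p: "p \<in> frontier \<Omega>"
  shows "\<exists>\<kappa>. has_boundary_curvature \<Omega> p \<kappa>"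
proof -
  have pU: "p \<in> U" "u p = 0" using p frontier by auto
  define X Y where "X = ux p" and "Y = uy p"
  define n2 where "n2 = X\<^sup>2 + Y\<^sup>2"
  have n2: "n2 > 0" using regular[OF pU] by (auto simp: n2_def X_def Y_def sum_power2_gt_zero_iff)
  \<comment> \<open>Minus the Jacobian determinant of the straightening map \<open>\<Phi>\<close>.
    It is positive at \<open>p\<close>, and restricting to where it stays positive keeps the linear
    system for the velocity solvable.\<close>
  define D where "D q = Y * uy q + X * ux q" for q
  have Dp: "D p = n2" by (simp add: D_def n2_def X_def Y_def power2_eq_square)
  have contu: "continuous_on S ux" "continuous_on S uy" for S
    using grad by (simp_all add: has_gradient_continuous)
  define U1 where "U1 = U \<inter> {q. D q > 0}"
  have U1: "open U1" "p \<in> U1"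
    using U pU n2 Dp unfolding U1_def D_def
    by (auto intro!: open_Collect_less continuous_intros contu)
  define \<Phi> where "\<Phi> q = (u q, Y * fst q - X * snd q)" for q
  define D\<Phi> where "D\<Phi> q = (\<lambda>h::real \<times> real. (fst h * ux q + snd h * uy q, Y * fst h - X * snd h))" for q
  have blin: "bounded_linear (D\<Phi> q)" for q
    unfolding D\<Phi>_def by (intro bounded_linear_intros)
  \<comment> \<open>The derivative of \<open>\<Phi>\<close> at \<open>p\<close> has the rows (X, Y)
    and (Y, -X). Its square is \<open>n2\<close> times the identity, so it is its own inverse up to
    this factor.\<close>
  have inv_blin: "bounded_linear (\<lambda>w. (1 / n2) *\<^sub>R (fst w * X + snd w * Y, fst w * Y - snd w * X))"
    by (intro bounded_linear_intros)
  have der\<Phi>: "(\<Phi> has_derivative blinfun_apply (Blinfun (D\<Phi> q))) (at q)" for q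
  proof -
    have "(\<Phi> has_derivative D\<Phi> q) (at q)"
      unfolding \<Phi>_def D\<Phi>_def
      by (auto intro!: derivative_eq_intros has_gradientD[OF grad(1)])
    then show ?thesis by (simp add: bounded_linear_Blinfun_apply[OF blin])
  qed
  have cont\<Phi>: "continuous_on U1 (\<lambda>q. Blinfun (D\<Phi> q))"
    by (rule continuous_on_blinfun_componentwise, unfold bounded_linear_Blinfun_apply[OF blin])
      (auto simp: D\<Phi>_def intro!: continuous_intros contu)
  have inv\<Phi>: "Blinfun (\<lambda>w. (1 / n2) *\<^sub>R (fst w * X + snd w * Y, fst w * Y - snd w * X))
      o\<^sub>L Blinfun (D\<Phi> p) = id_blinfun"
  proof (rule blinfun_eqI)
    fix h :: "real \<times> real"
    have "(1 / n2) *\<^sub>R ((fst h * X + snd h * Y) * X + (Y * fst h - X * snd h) * Y,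
        (fst h * X + snd h * Y) * Y - (Y * fst h - X * snd h) * X) = h"
    proof -
      have "(fst h * X + snd h * Y) * X + (Y * fst h - X * snd h) * Y = n2 * fst h"
        "(fst h * X + snd h * Y) * Y - (Y * fst h - X * snd h) * X = n2 * snd h"
        unfolding n2_def by algebra+
      then show ?thesis using n2 by (simp add: prod_eq_iff)
    qed
    then show "blinfun_apply (Blinfun (\<lambda>w. (1 / n2) *\<^sub>R (fst w * X + snd w * Y, fst w * Y - snd w * X))
        o\<^sub>L Blinfun (D\<Phi> p)) h = blinfun_apply id_blinfun h"
      unfolding blinfun_apply_blinfun_compose bounded_linear_Blinfun_apply[OF blin]
        bounded_linear_Blinfun_apply[OF inv_blin]
      by (simp add: D\<Phi>_def X_def[symmetric] Y_def[symmetric])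
  qed
  obtain U' V g g' where *: "open U'" "U' \<subseteq> U1" "p \<in> U'" "open V" "\<Phi> p \<in> V" "homeomorphism U' V \<Phi> g"
    "\<And>y. y \<in> V \<Longrightarrow> (g has_derivative (g' y)) (at y)"
    using inverse_function_theorem[OF U1(1) der\<Phi> cont\<Phi> U1(2) inv\<Phi>] by metis
  \<comment> \<open>The speed \<open>n2\<close> makes the initial velocity (Y, -X), whose left
    normal is the gradient (X, Y); hence the domain lies on the left.\<close>
  define c where "c t = (0 :: real, Y * fst p - X * snd p) + t *\<^sub>R (0, n2)" for t
  have c0: "c 0 = \<Phi> p" by (simp add: c_def \<Phi>_def pU)
  have contc: "continuous_on UNIV c" unfolding c_def by (intro continuous_intros)
  have "open (c -` V)" using contc *(4) by (simp add: open_vimage)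
  moreover have "0 \<in> c -` V" using c0 *(5) by simp
  ultimately obtain r where "r > 0" "ball 0 r \<subseteq> c -` V" by (meson open_contains_ball)
  then have r: "r > 0" "\<And>t. t \<in> {-r<..<r} \<Longrightarrow> c t \<in> V"
    by (auto simp: ball_eq_greaterThanLessThan)
  define \<gamma> where "\<gamma> t = g (c t)" for t
  have \<gamma>U: "\<gamma> t \<in> U1" and \<Phi>\<gamma>: "\<Phi> (\<gamma> t) = c t" if "t \<in> {-r<..<r}" for t
    using *(2,6) r(2)[OF that] unfolding \<gamma>_def homeomorphism_def by auto
  have u\<gamma>: "u (\<gamma> t) = 0" and T\<gamma>: "Y * fst (\<gamma> t) - X * snd (\<gamma> t) = Y * fst p - X * snd p + t * n2"
    if "t \<in> {-r<..<r}" for t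
    using \<Phi>\<gamma>[OF that] by (auto simp: \<Phi>_def c_def)
  define F1 F2 where "F1 q = n2 * uy q / D q" and "F2 q = - (n2 * ux q / D q)" for q
  define \<gamma>' where "\<gamma>' t = (F1 (\<gamma> t), F2 (\<gamma> t))" for t
  have D\<gamma>: "D (\<gamma> t) > 0" if "t \<in> {-r<..<r}" for t
    using \<gamma>U[OF that] by (auto simp: U1_def)
  have der\<gamma>: "(\<gamma> has_vector_derivative \<gamma>' t) (at t)" if t: "t \<in> {-r<..<r}" for t
  proof -
    have "(c has_vector_derivative (0, n2)) (at t)"
      unfolding c_def by (auto intro!: derivative_eq_intros)
    then have "(\<gamma> has_derivative (\<lambda>h. g' (c t) (h *\<^sub>R (0, n2)))) (at t)"
      unfolding \<gamma>_def has_vector_derivative_def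
      by (rule has_derivative_compose) (rule *(7)[OF r(2)[OF t]])
    then have "\<gamma> differentiable (at t)" by (rule differentiableI)
    then obtain k where k: "(\<gamma> has_vector_derivative k) (at t)"
      using vector_derivative_works by blast
    \<comment> \<open>The velocity is determined by two linear equations: \<open>u\<close> is
      constant along the curve, and the tangential position moves with speed
      \<open>n2\<close>.\<close>
    have k1: "fst k * ux (\<gamma> t) + snd k * uy (\<gamma> t) = 0"
    proof (rule DERIV_unique[OF has_gradient_compose_line[OF grad(1) k]])
      show "((\<lambda>t. u (\<gamma> t)) has_real_derivative 0) (at t)"
        by (rule has_field_derivative_transform_within_open[where f = "\<lambda>_. 0" and S = "{-r<..<r}"])
          (use t u\<gamma> in auto)
    qed
    have k2: "Y * fst k - X * snd k = n2"
    proof (rule DERIV_unique)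
      show "((\<lambda>t. Y * fst (\<gamma> t) - X * snd (\<gamma> t)) has_real_derivative Y * fst k - X * snd k) (at t)"
        using k
        by (auto simp: has_real_derivative_iff_has_vector_derivative has_vector_derivative_def
            algebra_simps intro!: derivative_eq_intros)
      show "((\<lambda>t. Y * fst (\<gamma> t) - X * snd (\<gamma> t)) has_real_derivative n2) (at t)"
        by (rule has_field_derivative_transform_within_open
            [where f = "\<lambda>t. Y * fst p - X * snd p + t * n2" and S = "{-r<..<r}"])
          (use t T\<gamma> in \<open>auto intro!: derivative_eq_intros\<close>)
    qed
    have "fst k * D (\<gamma> t) = n2 * uy (\<gamma> t)" "snd k * D (\<gamma> t) = - (n2 * ux (\<gamma> t))"
      using k1 k2 unfolding D_def by algebra+
    then have "k = \<gamma>' t"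
      using D\<gamma>[OF t] by (auto simp: \<gamma>'_def F1_def F2_def prod_eq_iff field_simps)
    then show ?thesis using k by simp
  qed
  define Dx Dy where "Dx q = Y * uxy q + X * uxx q" and "Dy q = Y * uyy q + X * uxy q" for q
  define A1 B1 A2 B2 where
    "A1 q = n2 * (uxy q * D q - uy q * Dx q) / (D q * D q)" and
    "B1 q = n2 * (uyy q * D q - uy q * Dy q) / (D q * D q)" and
    "A2 q = - (n2 * (uxx q * D q - ux q * Dx q) / (D q * D q))" and
    "B2 q = - (n2 * (uxy q * D q - ux q * Dy q) / (D q * D q))" for q
  define \<gamma>'' where "\<gamma>'' t = (fst (\<gamma>' t) * A1 (\<gamma> t) + snd (\<gamma>' t) * B1 (\<gamma> t),
    fst (\<gamma>' t) * A2 (\<gamma> t) + snd (\<gamma>' t) * B2 (\<gamma> t))" for t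
  have der\<gamma>': "(\<gamma>' has_vector_derivative \<gamma>'' t) (at t)" if t: "t \<in> {-r<..<r}" for t
  proof -
    note dx = has_gradient_compose_line[OF grad(2) der\<gamma>[OF t]]
    note dy = has_gradient_compose_line[OF grad(3) der\<gamma>[OF t]]
    have dD: "((\<lambda>t. D (\<gamma> t)) has_real_derivative
        fst (\<gamma>' t) * Dx (\<gamma> t) + snd (\<gamma>' t) * Dy (\<gamma> t)) (at t)"
      unfolding D_def Dx_def Dy_def
      by (rule derivative_eq_intros dx dy refl | simp add: algebra_simps)+
    have 1: "((\<lambda>t. F1 (\<gamma> t)) has_real_derivative
        fst (\<gamma>' t) * A1 (\<gamma> t) + snd (\<gamma>' t) * B1 (\<gamma> t)) (at t)"
      unfolding F1_def A1_def B1_def using D\<gamma>[OF t]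
      by (auto intro!: derivative_eq_intros dy dD simp: field_simps)
    have 2: "((\<lambda>t. F2 (\<gamma> t)) has_real_derivative
        fst (\<gamma>' t) * A2 (\<gamma> t) + snd (\<gamma>' t) * B2 (\<gamma> t)) (at t)"
      unfolding F2_def A2_def B2_def using D\<gamma>[OF t]
      by (auto intro!: derivative_eq_intros dx dD simp: field_simps)
    show ?thesis
      using has_vector_derivative_Pair[OF 1[unfolded has_real_derivative_iff_has_vector_derivative]
          2[unfolded has_real_derivative_iff_has_vector_derivative]]
      by (simp add: \<gamma>'_def[abs_def] \<gamma>''_def)
  qed
  have cont\<gamma>: "continuous_on {-r<..<r} \<gamma>" "continuous_on {-r<..<r} \<gamma>'"
    using der\<gamma> der\<gamma>' by (meson continuous_at_imp_continuous_on has_vector_derivative_continuous)+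
  have comp: "continuous_on {-r<..<r} (\<lambda>t. f (\<gamma> t))" if "continuous_on UNIV f" for f :: "real \<times> real \<Rightarrow> real"
    by (rule continuous_on_compose2[OF that cont\<gamma>(1)]) auto
  have D0: "\<forall>t\<in>{-r<..<r}. D (\<gamma> t) * D (\<gamma> t) \<noteq> 0" using D\<gamma> by force
  have contD: "continuous_on UNIV D" "continuous_on UNIV Dx" "continuous_on UNIV Dy"
    unfolding D_def[abs_def] Dx_def[abs_def] Dy_def[abs_def]
    by (intro continuous_intros cont contu)+
  have "continuous_on {-r<..<r} \<gamma>''"
    unfolding \<gamma>''_def[abs_def] A1_def B1_def A2_def B2_def
    by (intro continuous_intros cont\<gamma> comp contD cont contu D0)
  moreover have "\<gamma>' t \<noteq> 0" if t: "t \<in> {-r<..<r}" for t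
  proof -
    have "ux (\<gamma> t) \<noteq> 0 \<or> uy (\<gamma> t) \<noteq> 0" using D\<gamma>[OF t] by (auto simp: D_def)
    then show ?thesis using n2 D\<gamma>[OF t] by (auto simp: \<gamma>'_def F1_def F2_def zero_prod_def)
  qed
  moreover have \<gamma>0: "\<gamma> 0 = p"
    using *(3,6) by (simp add: \<gamma>_def c0 homeomorphism_def)
  moreover have "\<gamma> t \<in> frontier \<Omega>" if t: "t \<in> {-r<..<r}" for t
    using \<gamma>U[OF t] u\<gamma>[OF t] frontier by (auto simp: U1_def)
  moreover have "\<forall>\<^sub>F s in at_right 0. p + s *\<^sub>R rot90 (\<gamma>' 0) \<in> \<Omega>"
  proof -
    have \<gamma>'0: "\<gamma>' 0 = (Y, - X)"
      using n2 by (simp add: \<gamma>'_def \<gamma>0 F1_def F2_def Dp X_def Y_def)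
    have l: "((\<lambda>s. p + s *\<^sub>R rot90 (\<gamma>' 0)) has_vector_derivative rot90 (\<gamma>' 0)) (at 0)"
      by (auto intro!: derivative_eq_intros)
    from has_gradient_compose_line[OF grad(1) l]
    have "((\<lambda>s. u (p + s *\<^sub>R rot90 (\<gamma>' 0))) has_real_derivative n2) (at 0)"
      by (simp add: \<gamma>'0 rot90_def X_def Y_def n2_def power2_eq_square zero_prod_def[symmetric])
    from has_real_derivative_pos_inc_right[OF this n2]
    obtain e where e: "e > 0" "\<And>h. h > 0 \<Longrightarrow> h < e \<Longrightarrow> u p < u (p + h *\<^sub>R rot90 (\<gamma>' 0))" by auto
    then have "\<forall>\<^sub>F s in at_right 0. u (p + s *\<^sub>R rot90 (\<gamma>' 0)) > 0"
      using pU unfolding eventually_at_right_field by auto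
    moreover have "\<forall>\<^sub>F s in at_right 0. p + s *\<^sub>R rot90 (\<gamma>' 0) \<in> U"
    proof -
      have "((\<lambda>s. p + s *\<^sub>R rot90 (\<gamma>' 0)) \<longlongrightarrow> p + 0 *\<^sub>R rot90 (\<gamma>' 0)) (at_right 0)"
        by (intro tendsto_intros)
      then show ?thesis using U pU(1) by (simp add: topological_tendstoD)
    qed
    ultimately show ?thesis by eventually_elim (simp add: \<Omega>)
  qed
  ultimately show ?thesis
    unfolding has_boundary_curvature_def using r(1) der\<gamma> der\<gamma>' by blast
qed

lemma Curv_eq: "p \<in> frontier \<Omega> \<Longrightarrow> Curv \<Omega> p = level_curvature p"
  unfolding Curv_def
  using has_boundary_curvature_exists has_boundary_curvature_imp by (metis the_equality)

end

section \<open>The perturbed strip\<close>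

lemma abs_sinh_le_cosh: "\<bar>sinh y\<bar> \<le> cosh (y::real)"
  using sinh_less_cosh_real[of y] sinh_less_cosh_real[of "-y"] by simp

lemma cosh_le_cosh: "\<bar>y\<bar> \<le> b \<Longrightarrow> cosh y \<le> cosh (b::real)"
  using cosh_real_nonneg_le_iff[of "\<bar>y\<bar>" b] by (simp add: abs_if split: if_splits)

lemma abs_mult_bounded: "\<bar>s\<bar> \<le> 1 \<Longrightarrow> \<bar>t\<bar> \<le> c \<Longrightarrow> \<bar>s * t\<bar> \<le> (c::real)"
  using mult_mono[of "\<bar>s\<bar>" 1 "\<bar>t\<bar>" c] by (simp add: abs_mult)

locale bumps =
  fixes a m :: real
  assumes a: "a > 0" and m: "m > 0"
begin

text \<open>With z = x + i y this is Re (cos z - a z^4) + m Im z^3.\<close>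

definition v :: "real \<times> real \<Rightarrow> real" where
  "v p = cos (fst p) * cosh (snd p) - a * (fst p ^ 4 - 6 * fst p ^ 2 * snd p ^ 2 + snd p ^ 4)
     + m * (3 * fst p ^ 2 * snd p - snd p ^ 3)"

definition vx :: "real \<times> real \<Rightarrow> real" where
  "vx p = - sin (fst p) * cosh (snd p) - a * (4 * fst p ^ 3 - 12 * fst p * snd p ^ 2)
     + 6 * m * fst p * snd p"

definition vy :: "real \<times> real \<Rightarrow> real" where
  "vy p = cos (fst p) * sinh (snd p) - a * (4 * snd p ^ 3 - 12 * fst p ^ 2 * snd p)
     + m * (3 * fst p ^ 2 - 3 * snd p ^ 2)"

definition vxy :: "real \<times> real \<Rightarrow> real" where
  "vxy p = - sin (fst p) * sinh (snd p) + 24 * a * fst p * snd p + 6 * m * fst p"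

definition vyy :: "real \<times> real \<Rightarrow> real" where
  "vyy p = cos (fst p) * cosh (snd p) + 12 * a * (fst p ^ 2 - snd p ^ 2) - 6 * m * snd p"

lemma analytic_expr_v:
  "v \<in> analytic_expr" "vx \<in> analytic_expr" "vy \<in> analytic_expr" "vxy \<in> analytic_expr" "vyy \<in> analytic_expr"
  unfolding v_def[abs_def] vx_def[abs_def] vy_def[abs_def] vxy_def[abs_def] vyy_def[abs_def]
  by (intro analytic_expr_intros)+

lemma has_gradient_v: "has_gradient v vx vy"
  unfolding has_gradient_def v_def[abs_def] vx_def vy_def
  by (auto intro!: derivative_eq_intros has_derivative_sinh_snd has_derivative_cosh_snd
      simp: fun_eq_iff algebra_simps)

lemma has_gradient_vx: "has_gradient vx (\<lambda>p. - vyy p) vxy"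
  unfolding has_gradient_def vx_def[abs_def] vyy_def vxy_def
  by (auto intro!: derivative_eq_intros has_derivative_sinh_snd has_derivative_cosh_snd
      simp: fun_eq_iff algebra_simps)

lemma has_gradient_vy: "has_gradient vy vxy vyy"
  unfolding has_gradient_def vy_def[abs_def] vyy_def vxy_def
  by (auto intro!: derivative_eq_intros has_derivative_sinh_snd has_derivative_cosh_snd
      simp: fun_eq_iff algebra_simps)

definition u :: "real \<Rightarrow> real \<times> real \<Rightarrow> real" where
  "u e p = (1 - snd p ^ 2) / 2 + e * v p"

definition ux where "ux e p = e * vx p"
definition uy where "uy e p = - snd p + e * vy p"
definition uxx where "uxx e p = - e * vyy p"
definition uxy where "uxy e p = e * vxy p"
definition uyy where "uyy e p = - 1 + e * vyy p"

lemma analytic_expr_u: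
  "u e \<in> analytic_expr" "ux e \<in> analytic_expr" "uy e \<in> analytic_expr"
  "uxx e \<in> analytic_expr" "uxy e \<in> analytic_expr" "uyy e \<in> analytic_expr"
  unfolding u_def[abs_def] ux_def[abs_def] uy_def[abs_def] uxx_def[abs_def] uxy_def[abs_def]
    uyy_def[abs_def] divide_inverse
  by (intro analytic_expr_intros analytic_expr_v)+

lemma has_gradient_u:
  "has_gradient (u e) (ux e) (uy e)" "has_gradient (ux e) (uxx e) (uxy e)"
  "has_gradient (uy e) (uxy e) (uyy e)"
  unfolding has_gradient_def u_def[abs_def] ux_def[abs_def] uy_def[abs_def] uxx_def uxy_def uyy_def
  by (auto intro!: derivative_eq_intros has_gradientD[OF has_gradient_v]
      has_gradientD[OF has_gradient_vx] has_gradientD[OF has_gradient_vy]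
      simp: fun_eq_iff algebra_simps)

text \<open>The cut at height 2 discards far regions near the diagonals, where -a Re z^4 is
  positive. For small \<open>e\<close> it adds no boundary, because \<open>u e\<close> is negative
  on |y| = 2.\<close>

definition \<Omega> :: "real \<Rightarrow> (real \<times> real) set" where
  "\<Omega> e = {p. \<bar>snd p\<bar> < 2 \<and> u e p > 0}"

text \<open>For |y| <= 2 everything but the quartic is at most quadratic in x. The operator r . grad
  - 2 doubles a homogeneous quartic and preserves a cubic, so -a x^4 keeps its sign in both
  estimates and absorbs the quadratic terms.\<close>

lemma v_bounds:
  "\<exists>K>0. \<forall>p. \<bar>snd p\<bar> \<le> 2 \<longrightarrow>
     v p \<le> K - a / 2 * fst p ^ 4 \<and> fst p * vx p + snd p * vy p \<le> 2 * v p + K"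
proof -
  define H where "H = cosh (2::real)"
  have H: "H > 0" by (simp add: H_def)
  have sq: "B * t - c * t\<^sup>2 \<le> B\<^sup>2 / (4 * c)" if "c > 0" for B c t :: real
  proof -
    have "0 \<le> (2 * c * t - B)\<^sup>2" by simp
    then show ?thesis using that by (simp add: field_simps power2_eq_square)
  qed
  define B1 B2 where "B1 = 24 * a + 6 * m" and "B2 = H + 48 * a + 6 * m"
  \<comment> \<open>The sum of two positive constants, one for each estimate; \<open>B1\<close> and
    \<open>B2\<close> collect the coefficients of x^2, and the quotients are the maxima of the
    resulting parabolas in x^2. In the first estimate only half of the quartic is spent.\<close>
  define K where "K = (H + 8 * m + B1\<^sup>2 / (2 * a)) + (5 * H + 8 * m + B2\<^sup>2 / (8 * a))"
  have nn: "H + 8 * m + B1\<^sup>2 / (2 * a) > 0" "5 * H + 8 * m + B2\<^sup>2 / (8 * a) > 0"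
    using H a m by (auto intro!: add_pos_nonneg)
  have *: "v (x, y) \<le> K - a / 2 * x ^ 4 \<and> x * vx (x, y) + y * vy (x, y) \<le> 2 * v (x, y) + K"
    if y: "\<bar>y\<bar> \<le> 2" for x y
  proof -
    have ch: "\<bar>cosh y\<bar> \<le> H" "\<bar>sinh y\<bar> \<le> H"
      using cosh_le_cosh[OF y] abs_sinh_le_cosh[of y] by (auto simp: H_def)
    have cc: "\<bar>cos x * cosh y\<bar> \<le> H" "\<bar>cos x * sinh y\<bar> \<le> H" "\<bar>sin x * cosh y\<bar> \<le> H"
      using ch by (auto intro!: abs_mult_bounded)
    have y2: "y\<^sup>2 \<le> 4" using y abs_le_square_iff[of y 2] by simp
    have y3: "\<bar>y ^ 3\<bar> \<le> 8" using power_mono[OF y, of 3] by (simp add: power_abs)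
    have xy2: "x\<^sup>2 * y\<^sup>2 \<le> 4 * x\<^sup>2" using mult_left_mono[OF y2, of "x\<^sup>2"] by simp
    have xy: "x\<^sup>2 * y \<le> 2 * x\<^sup>2" using mult_left_mono[of y 2 "x\<^sup>2"] y unfolding abs_le_iff by simp
    have axy2: "a * (x\<^sup>2 * y\<^sup>2) \<le> a * (4 * x\<^sup>2)" using xy2 a by simp
    have mxy: "m * (x\<^sup>2 * y) \<le> m * (2 * x\<^sup>2)" using xy m by simp
    have my3: "m * (- (y ^ 3)) \<le> m * 8" using y3 m by (intro mult_left_mono) auto
    have ay4: "a * y ^ 4 \<ge> 0" using a by simp
    have "v (x, y) = cos x * cosh y - a * x ^ 4 + 6 * (a * (x\<^sup>2 * y\<^sup>2)) - a * y ^ 4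
        + 3 * (m * (x\<^sup>2 * y)) + m * (- (y ^ 3))"
      by (simp add: v_def algebra_simps)
    also have "\<dots> \<le> H + 8 * m + (B1 * x\<^sup>2 - (a / 2) * (x\<^sup>2)\<^sup>2) - (a / 2) * x ^ 4"
      using cc axy2 mxy my3 ay4 by (simp add: B1_def algebra_simps)
    also have "\<dots> \<le> H + 8 * m + B1\<^sup>2 / (2 * a) - (a / 2) * x ^ 4"
      using sq[of "a / 2" B1 "x\<^sup>2"] a by simp
    finally have 1: "v (x, y) \<le> H + 8 * m + B1\<^sup>2 / (2 * a) - (a / 2) * x ^ 4" .
    have ysh: "y * (cos x * sinh y) \<le> 2 * H"
    proof -
      have "\<bar>y * (cos x * sinh y)\<bar> \<le> 2 * H"
        unfolding abs_mult[of y] using y cc H by (intro mult_mono) auto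
      then show ?thesis by simp
    qed
    have xsc: "- (x * (sin x * cosh y)) \<le> H * (1 + x\<^sup>2)"
    proof -
      have "\<bar>x * (sin x * cosh y)\<bar> \<le> (1 + x\<^sup>2) * H"
        unfolding abs_mult[of x] using cc H
      proof (intro mult_mono)
        have "0 \<le> (\<bar>x\<bar> - 1)\<^sup>2 + x\<^sup>2 + 1" by simp
        then show "\<bar>x\<bar> \<le> 1 + x\<^sup>2" by (simp add: power2_diff)
      qed auto
      then show ?thesis by (simp add: mult.commute)
    qed
    have "x * vx (x, y) + y * vy (x, y) - 2 * v (x, y) =
      - (x * (sin x * cosh y)) + y * (cos x * sinh y) - 2 * (cos x * cosh y) - 2 * (a * x ^ 4)
      + 12 * (a * (x\<^sup>2 * y\<^sup>2)) - 2 * (a * y ^ 4) + 3 * (m * (x\<^sup>2 * y)) + m * (- (y ^ 3))"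
      unfolding v_def vx_def vy_def fst_conv snd_conv by algebra
    also have "\<dots> \<le> 5 * H + 8 * m + (B2 * x\<^sup>2 - 2 * a * (x\<^sup>2)\<^sup>2)"
      using cc ysh xsc axy2 mxy my3 ay4 by (simp add: B2_def algebra_simps)
    also have "\<dots> \<le> 5 * H + 8 * m + B2\<^sup>2 / (8 * a)"
      using sq[of "2 * a" B2 "x\<^sup>2"] a by simp
    finally have 2: "x * vx (x, y) + y * vy (x, y) - 2 * v (x, y) \<le> 5 * H + 8 * m + B2\<^sup>2 / (8 * a)" .
    show ?thesis using 1 2 nn unfolding K_def by linarith
  qed
  have "v p \<le> K - a / 2 * fst p ^ 4 \<and> fst p * vx p + snd p * vy p \<le> 2 * v p + K"
    if "\<bar>snd p\<bar> \<le> 2" for p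
    using *[OF that, of "fst p"] by simp
  moreover have "K > 0" using add_pos_pos[OF nn] by (simp only: K_def)
  ultimately show ?thesis by (intro exI[of _ K] conjI allI impI) auto
qed

end

section \<open>Radial monotonicity, starshapedness and regularity of the domain\<close>

locale perturbed_strip = bumps +
  fixes K e :: real
  assumes v_le: "\<bar>snd p\<bar> \<le> 2 \<Longrightarrow> v p \<le> K - a / 2 * fst p ^ 4"
    and radial_v: "\<bar>snd p\<bar> \<le> 2 \<Longrightarrow> fst p * vx p + snd p * vy p \<le> 2 * v p + K"
    and e: "e > 0" and K: "K > 0" and eK: "e * K \<le> 1 / 4"
begin

lemma u_le: "\<bar>snd p\<bar> \<le> 2 \<Longrightarrow> u e p \<le> (1 - snd p ^ 2) / 2 + e * K - e * a / 2 * fst p ^ 4"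
  using mult_left_mono[OF v_le[of p], of e] e by (simp add: u_def algebra_simps)

text \<open>All three follow from e a x^4 + y^2 <= 1 + 2 e K <= 3/2. The first gives boundedness and
  later controls e x^2 far out; the last shows that the cut at height 2 never meets the zero
  set.\<close>

lemma nonneg_bounds:
  assumes "\<bar>snd p\<bar> \<le> 2" "u e p \<ge> 0"
  shows "e * a * fst p ^ 4 \<le> 2" "snd p ^ 2 \<le> 1 + 2 * e * K" "\<bar>snd p\<bar> < 2"
proof -
  have x4: "e * a * fst p ^ 4 \<ge> 0" using e a by simp
  have le: "e * a * fst p ^ 4 + snd p ^ 2 \<le> 1 + 2 * e * K"
    using u_le[OF assms(1)] assms(2) by (simp add: field_simps)
  show "e * a * fst p ^ 4 \<le> 2" using le eK zero_le_power2[of "snd p"] by linarith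
  show 2: "snd p ^ 2 \<le> 1 + 2 * e * K" using le x4 by linarith
  have "\<bar>snd p\<bar> \<noteq> 2"
  proof
    assume "\<bar>snd p\<bar> = 2"
    then have "snd p ^ 2 = 2\<^sup>2" by (metis power2_abs)
    then show False using 2 eK by simp
  qed
  then show "\<bar>snd p\<bar> < 2" using assms(1) by simp
qed

text \<open>For the unperturbed profile r . grad u - 2 u is exactly -1, and the perturbation raises
  it by at most e K <= 1/4. Besides the radial monotonicity this yields a nonzero gradient wherever
  u vanishes.\<close>

lemma radial_u:
  assumes "\<bar>snd p\<bar> \<le> 2"
  shows "fst p * ux e p + snd p * uy e p \<le> 2 * u e p - 3 / 4"
proof -
  have "e * (fst p * vx p + snd p * vy p) \<le> e * (2 * v p + K)"
    using radial_v[OF assms] e by simp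
  then show ?thesis using eK
    by (simp add: ux_def uy_def u_def field_simps power2_eq_square)
qed

text \<open>The quotient \<open>u (t p) / t\<^sup>2\<close> decreases in \<open>t\<close>, as its derivative is
  \<open>(r \<cdot> \<nabla>u - 2 u) / t\<^sup>3\<close> at \<open>r = t p\<close>.\<close>

lemma u_scaled_gt:
  assumes "\<bar>snd p\<bar> \<le> 2" "0 < t" "t < 1"
  shows "u e (t *\<^sub>R p) > t\<^sup>2 * u e p"
proof -
  define h where "h s = u e (s *\<^sub>R p) / s\<^sup>2" for s
  have "h t > h 1"
  proof (rule DERIV_neg_imp_decreasing[OF assms(3)])
    fix s assume s: "t \<le> s" "s \<le> 1"
    then have s0: "s > 0" using assms by simp
    have "((\<lambda>s. s *\<^sub>R p) has_vector_derivative p) (at s)"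
      by (auto intro!: derivative_eq_intros)
    from has_gradient_compose_line[OF has_gradient_u(1) this]
    have d: "((\<lambda>s. u e (s *\<^sub>R p)) has_real_derivative
      fst p * ux e (s *\<^sub>R p) + snd p * uy e (s *\<^sub>R p)) (at s)" .
    let ?D = "s * (fst p * ux e (s *\<^sub>R p) + snd p * uy e (s *\<^sub>R p)) - 2 * u e (s *\<^sub>R p)"
    have "(h has_real_derivative ?D / s ^ 3) (at s)"
      unfolding h_def using s0
      by (auto intro!: derivative_eq_intros d simp: field_simps power2_eq_square power3_eq_cube)
    moreover have "\<bar>snd (s *\<^sub>R p)\<bar> \<le> 2"
      using mult_mono[of s 1 "\<bar>snd p\<bar>" 2] s s0 assms(1) by (simp add: abs_mult)
    then have "?D < 0"
      using radial_u[of "s *\<^sub>R p"] by (simp add: algebra_simps)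
    ultimately show "\<exists>y. (h has_real_derivative y) (at s) \<and> y < 0"
      using s0 by (intro exI[of _ "?D / s ^ 3"]) (simp add: divide_neg_pos)
  qed
  then show ?thesis using assms by (simp add: h_def field_simps)
qed

lemma open_\<Omega>: "open (\<Omega> e)"
proof -
  have "\<Omega> e = {p. \<bar>snd p\<bar> < 2} \<inter> {p. u e p > 0}" by (auto simp: \<Omega>_def)
  then show ?thesis
    using analytic_expr_continuous[OF analytic_expr_u(1)]
    by (auto intro!: open_Collect_less continuous_intros)
qed

lemma closure_\<Omega>: "closure (\<Omega> e) \<subseteq> {p. \<bar>snd p\<bar> < 2 \<and> u e p \<ge> 0}"
proof -
  have "closed ({p. \<bar>snd p\<bar> \<le> 2} \<inter> {p. 0 \<le> u e p})"
    using analytic_expr_continuous[OF analytic_expr_u(1)]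
    by (intro closed_Int closed_Collect_le continuous_intros)
  then have "closure (\<Omega> e) \<subseteq> {p. \<bar>snd p\<bar> \<le> 2} \<inter> {p. 0 \<le> u e p}"
    by (intro closure_minimal) (auto simp: \<Omega>_def)
  then show ?thesis using nonneg_bounds(3) by auto
qed

text \<open>That every zero in the strip is a boundary point comes from scaling: at a zero p the
  points t p with 0 < t < 1 have positive \<open>u e\<close>, and they tend to p.\<close>

lemma frontier_\<Omega>: "frontier (\<Omega> e) = {p. \<bar>snd p\<bar> < 2 \<and> u e p = 0}"
proof
  show "frontier (\<Omega> e) \<subseteq> {p. \<bar>snd p\<bar> < 2 \<and> u e p = 0}"
  proof
    fix p assume "p \<in> frontier (\<Omega> e)"
    then have "p \<in> closure (\<Omega> e)" "p \<notin> \<Omega> e"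
      by (simp_all add: frontier_def interior_open[OF open_\<Omega>])
    then show "p \<in> {p. \<bar>snd p\<bar> < 2 \<and> u e p = 0}"
      using closure_\<Omega> by (force simp: \<Omega>_def)
  qed
  show "{p. \<bar>snd p\<bar> < 2 \<and> u e p = 0} \<subseteq> frontier (\<Omega> e)"
  proof
    fix p assume "p \<in> {p. \<bar>snd p\<bar> < 2 \<and> u e p = 0}"
    then have p: "\<bar>snd p\<bar> < 2" "u e p = 0" by auto
    have "(\<lambda>t. t *\<^sub>R p) ` {0<..<1} \<subseteq> \<Omega> e"
    proof
      fix q assume "q \<in> (\<lambda>t. t *\<^sub>R p) ` {0<..<1}"
      then obtain t where "q = t *\<^sub>R p" "t \<in> {0<..<1}" by blast
      then have t: "q = t *\<^sub>R p" "0 < t" "t < 1" by simp_all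
      have "\<bar>snd q\<bar> < 2"
        using mult_mono[of t 1 "\<bar>snd p\<bar>" "\<bar>snd p\<bar>"] t p(1) by (simp add: abs_mult)
      then show "q \<in> \<Omega> e" using u_scaled_gt[of p t] p t by (simp add: \<Omega>_def)
    qed
    then have "(\<lambda>t. t *\<^sub>R p) ` closure {0<..<1} \<subseteq> closure (\<Omega> e)"
      by (intro image_closure_subset continuous_intros closed_closure order_trans[OF _ closure_subset])
    moreover have "1 *\<^sub>R p \<in> (\<lambda>t. t *\<^sub>R p) ` closure {0<..<1}" by (rule imageI) simp
    ultimately have "1 *\<^sub>R p \<in> closure (\<Omega> e)" by (rule subsetD)
    then show "p \<in> frontier (\<Omega> e)"
      using p by (simp add: frontier_def interior_open[OF open_\<Omega>]) (simp add: \<Omega>_def)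
  qed
qed

lemma u_origin: "u e 0 > 1 / 2"
  using e by (simp add: u_def v_def)

lemma starlike_\<Omega>: "starlike (\<Omega> e)"
  unfolding starlike_def
proof (intro bexI ballI)
  show "0 \<in> \<Omega> e" using u_origin by (simp add: \<Omega>_def)
  fix p assume p: "p \<in> \<Omega> e"
  show "closed_segment 0 p \<subseteq> \<Omega> e"
  proof
    fix q assume "q \<in> closed_segment 0 p"
    then obtain t where t: "q = t *\<^sub>R p" "0 \<le> t" "t \<le> 1" by (auto simp: in_segment)
    have "\<bar>snd q\<bar> < 2"
      using mult_mono[of t 1 "\<bar>snd p\<bar>" "\<bar>snd p\<bar>"] t p by (simp add: abs_mult \<Omega>_def)
    moreover have "u e q > 0"
    proof (cases "t = 0 \<or> t = 1")
      case True
      then show ?thesis using p t u_origin by (auto simp: \<Omega>_def)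
    next
      case False
      then have "u e q > t\<^sup>2 * u e p" using u_scaled_gt[of p t] p t by (simp add: \<Omega>_def)
      moreover have "t\<^sup>2 * u e p \<ge> 0" using p by (simp add: \<Omega>_def)
      ultimately show ?thesis by simp
    qed
    ultimately show "q \<in> \<Omega> e" by (simp add: \<Omega>_def)
  qed
qed

lemma domain_\<Omega>: "domain (\<Omega> e)"
  using open_\<Omega> starlike_imp_connected[OF starlike_\<Omega>] by (simp add: domain_def)

lemma bounded_\<Omega>: "bounded (\<Omega> e)"
proof -
  \<comment> \<open>A crude radius: either |x| <= 1 or |x| <= x^4, and x^4 is at most 2 / (e
    a).\<close>
  define R where "R = 1 + 2 / (e * a)"
  have "fst p \<in> {-R..R} \<and> snd p \<in> {-2..2}" if p: "p \<in> \<Omega> e" for p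
  proof -
    have x4: "fst p ^ 4 \<le> 2 / (e * a)"
      using nonneg_bounds(1)[of p] p e a by (simp add: \<Omega>_def field_simps)
    have "\<bar>fst p\<bar> \<le> R"
    proof (cases "\<bar>fst p\<bar> \<le> 1")
      case True
      then show ?thesis using e a by (simp add: R_def add_increasing2)
    next
      case False
      then have "\<bar>fst p\<bar> \<le> \<bar>fst p\<bar> ^ 4" using power_increasing[of 1 4 "\<bar>fst p\<bar>"] by simp
      then show ?thesis using x4 by (simp add: R_def power_abs)
    qed
    then show ?thesis using p by (auto simp: \<Omega>_def)
  qed
  then have "\<Omega> e \<subseteq> {-R..R} \<times> {-2..2}" by (metis mem_Times_iff subsetI)
  then show ?thesis by (rule bounded_subset[rotated]) (intro bounded_Times bounded_closed_interval)
qed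

lemma regular_u: "\<bar>snd p\<bar> \<le> 2 \<Longrightarrow> u e p = 0 \<Longrightarrow> (ux e p, uy e p) \<noteq> (0, 0)"
  using radial_u[of p] by auto

sublocale level: regular_level_set "u e" "ux e" "uy e" "uxx e" "uxy e" "uyy e" "\<Omega> e" "{p. \<bar>snd p\<bar> < 2}"
proof
  show "open {p :: real \<times> real. \<bar>snd p\<bar> < 2}"
    by (intro open_Collect_less continuous_intros)
  show "(ux e q, uy e q) \<noteq> (0, 0)" if "q \<in> {p. \<bar>snd p\<bar> < 2}" "u e q = 0" for q
    using regular_u[of q] that by simp
  show "\<Omega> e = {q \<in> {p. \<bar>snd p\<bar> < 2}. 0 < u e q}" by (simp add: \<Omega>_def)
  show "frontier (\<Omega> e) = {q \<in> {p. \<bar>snd p\<bar> < 2}. u e q = 0}" by (simp add: frontier_\<Omega>)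
qed (rule has_gradient_u analytic_expr_continuous analytic_expr_u)+

lemma smooth_boundary_\<Omega>: "smooth_boundary (\<Omega> e)"
  unfolding smooth_boundary_def
proof
  fix p assume p: "p \<in> frontier (\<Omega> e)"
  \<comment> \<open>One neighbourhood and one defining function serve all boundary points: the part
    of the strip where the gradient of \<open>u e\<close> is nonzero, with \<open>u e\<close>
    itself.\<close>
  let ?U = "{p. \<bar>snd p\<bar> < 2} \<inter> {p. 0 < (ux e p)\<^sup>2 + (uy e p)\<^sup>2}"
  have "open ?U \<and> p \<in> ?U \<and> smooth_on ?U (u e) \<and>
      (\<forall>q\<in>?U. frechet_derivative (u e) (at q) \<noteq> (\<lambda>v. 0)) \<and>
      \<Omega> e \<inter> ?U = {q \<in> ?U. 0 < u e q} \<and> frontier (\<Omega> e) \<inter> ?U = {q \<in> ?U. u e q = 0}"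
  proof (intro conjI)
    show "open ?U"
      using analytic_expr_continuous[OF analytic_expr_u(2)] analytic_expr_continuous[OF analytic_expr_u(3)]
      by (intro open_Int open_Collect_less continuous_intros)
    show "p \<in> ?U" using p regular_u[of p] by (auto simp: frontier_\<Omega> sum_power2_gt_zero_iff)
    show "smooth_on ?U (u e)" by (rule analytic_expr_smooth[OF analytic_expr_u(1)])
    show "\<forall>q\<in>?U. frechet_derivative (u e) (at q) \<noteq> (\<lambda>v. 0)"
    proof
      fix q assume q: "q \<in> ?U"
      show "frechet_derivative (u e) (at q) \<noteq> (\<lambda>v. 0)"
        unfolding frechet_derivative_has_gradient[OF has_gradient_u(1)]
      proof
        assume h: "(\<lambda>h. fst h * ux e q + snd h * uy e q) = (\<lambda>v. 0)"
        from fun_cong[OF h, of "(1, 0)"] fun_cong[OF h, of "(0, 1)"] q show False by simp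
      qed
    qed
    show "\<Omega> e \<inter> ?U = {q \<in> ?U. 0 < u e q}" by (auto simp: \<Omega>_def)
    show "frontier (\<Omega> e) \<inter> ?U = {q \<in> ?U. u e q = 0}" by (auto simp: frontier_\<Omega>)
  qed
  then show "\<exists>U (\<phi> :: _ \<Rightarrow> real). open U \<and> p \<in> U \<and> smooth_on U \<phi> \<and>
      (\<forall>q\<in>U. frechet_derivative \<phi> (at q) \<noteq> (\<lambda>v. 0)) \<and>
      \<Omega> e \<inter> U = {q \<in> U. 0 < \<phi> q} \<and> frontier (\<Omega> e) \<inter> U = {q \<in> U. \<phi> q = 0}"
    by (intro exI)
qed

lemma torsion_solution_u: "torsion_solution (\<Omega> e) (u e)"
  unfolding torsion_solution_def
proof (intro conjI ballI)
  fix p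
  show "u e p = 0" if "p \<in> frontier (\<Omega> e)" using that by (simp add: frontier_\<Omega>)
  show "u e p > 0" if "p \<in> \<Omega> e" using that by (simp add: \<Omega>_def)
  show "- laplacian (u e) p = 1"
    by (simp add: has_gradient_laplacian[OF has_gradient_u] uxx_def uyy_def)
qed (intro analytic_expr_smooth analytic_expr_continuous analytic_expr_u)+

end

section \<open>Maximum points\<close>

context perturbed_strip
begin

section \<open>Convergence to the strip\<close>

lemma \<Omega>_subset_strip:
  assumes "e * K < \<delta>" "p \<in> \<Omega> e"
  shows "\<bar>snd p\<bar> < 1 + \<delta>"
proof -
  have "0 < e * K" using e K by simp
  then have "0 < \<delta>" using assms(1) by linarith
  have "\<bar>snd p\<bar>\<^sup>2 \<le> 1 + 2 * (e * K)"
    using nonneg_bounds(2)[of p] assms(2) by (simp add: \<Omega>_def mult.assoc)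
  also have "\<dots> < 1 + 2 * \<delta>" using assms(1) by simp
  also have "\<dots> \<le> (1 + \<delta>)\<^sup>2" by (simp add: power2_sum)
  finally show ?thesis using \<open>0 < \<delta>\<close> by (intro power2_less_imp_less[of "\<bar>snd p\<bar>"]) auto
qed

lemma strip_subset_\<Omega>:
  assumes "0 < \<delta>" "\<delta> < 1" "\<bar>v p\<bar> \<le> M" "e * M < \<delta> / 2" "\<bar>snd p\<bar> < 1 - \<delta>"
  shows "p \<in> \<Omega> e"
proof -
  have "\<bar>e * v p\<bar> \<le> e * M" using e assms(3) by (simp add: abs_mult)
  moreover have "\<bar>snd p\<bar>\<^sup>2 \<le> (1 - \<delta>)\<^sup>2" using assms by (intro power_mono) auto
  then have "snd p ^ 2 \<le> 1 - 2 * \<delta> + \<delta>\<^sup>2" by (simp add: power2_diff)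
  \<comment> \<open>Since \<open>1 - snd p ^ 2\<close> is at least
    \<open>2 * \<delta> - \<delta>\<^sup>2\<close>, the unperturbed profile exceeds
    \<open>\<delta> / 2\<close>, which outweighs the perturbation.\<close>
  moreover have "\<delta>\<^sup>2 < \<delta>" using assms by (simp add: power2_eq_square)
  ultimately have "u e p > 0" using assms(4) unfolding u_def by (simp add: abs_le_iff field_simps)
  then show ?thesis using assms by (simp add: \<Omega>_def)
qed

section \<open>Separation of the bumps by vertical lines\<close>

text \<open>On such a line v <= -1 + D |y|. Near the axis the -1 wins; elsewhere -y^2/2 in the
  profile does. Completing the square in |y| - e D joins the two cases, and the error e^2 D^2 is
  paid by 2 e, which is the hypothesis on \<open>e\<close>.\<close>

lemma u_separating_line:
  assumes "cos x = - 1" "x\<^sup>2 \<le> R" "e * ((12 * a + 3 * m) * R + 4 * m)\<^sup>2 \<le> 2" "\<bar>y\<bar> \<le> 2"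
  shows "u e (x, y) \<le> 1 / 2"
proof -
  define D where "D = (12 * a + 3 * m) * R + 4 * m"
  have y2: "y\<^sup>2 \<le> 2 * \<bar>y\<bar>" using mult_right_mono[OF assms(4), of "\<bar>y\<bar>"] by (simp add: power2_eq_square)
  have y2': "y\<^sup>2 \<le> 4" using assms(4) abs_le_square_iff[of y 2] by simp
  have y3: "- (y ^ 3) \<le> 4 * \<bar>y\<bar>"
  proof -
    have "\<bar>y ^ 3\<bar> = y\<^sup>2 * \<bar>y\<bar>" by (simp add: power3_eq_cube power2_eq_square abs_mult)
    also have "\<dots> \<le> 4 * \<bar>y\<bar>" using y2' by (intro mult_right_mono) auto
    finally show ?thesis by (simp add: abs_le_iff)
  qed
  have R: "R \<ge> 0" using assms(2) zero_le_power2[of x] by linarith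
  have t1: "a * (x\<^sup>2 * y\<^sup>2) \<le> a * (R * (2 * \<bar>y\<bar>))"
    using a R assms(2) y2 by (intro mult_left_mono mult_mono) auto
  have t2: "m * (x\<^sup>2 * y) \<le> m * (R * \<bar>y\<bar>)"
  proof -
    have "x\<^sup>2 * y \<le> x\<^sup>2 * \<bar>y\<bar>" by (intro mult_left_mono) auto
    also have "\<dots> \<le> R * \<bar>y\<bar>" using assms(2) by (intro mult_right_mono) auto
    finally show ?thesis using m by simp
  qed
  have t3: "m * - (y ^ 3) \<le> m * (4 * \<bar>y\<bar>)" using m y3 by (intro mult_left_mono) auto
  have nn: "a * x ^ 4 \<ge> 0" "a * y ^ 4 \<ge> 0" using a by simp_all
  have "v (x, y) = - cosh y - a * x ^ 4 + 6 * (a * (x\<^sup>2 * y\<^sup>2)) - a * y ^ 4 + 3 * (m * (x\<^sup>2 * y)) + m * - (y ^ 3)"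
    by (simp add: v_def assms(1) algebra_simps)
  also have "\<dots> \<le> - 1 + 6 * (a * (R * (2 * \<bar>y\<bar>))) + 3 * (m * (R * \<bar>y\<bar>)) + m * (4 * \<bar>y\<bar>)"
    using t1 t2 t3 nn cosh_real_ge_1[of y] by linarith
  also have "\<dots> = - 1 + D * \<bar>y\<bar>" by (simp add: D_def algebra_simps)
  finally have "e * v (x, y) \<le> e * (- 1 + D * \<bar>y\<bar>)" using e by simp
  moreover have "0 \<le> (\<bar>y\<bar> - e * D)\<^sup>2" by simp
  then have "2 * (e * D * \<bar>y\<bar>) \<le> y\<^sup>2 + e * (e * D\<^sup>2)"
    by (simp add: power2_diff power_mult_distrib power2_eq_square algebra_simps)
  moreover have "e * (e * D\<^sup>2) \<le> e * 2" using assms(3) e by (simp add: D_def)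
  ultimately have "2 * (e * v (x, y)) \<le> y\<^sup>2" by (simp add: algebra_simps)
  then show ?thesis by (simp add: u_def field_simps)
qed

lemma cos_odd_multiple_pi: "cos ((2 * real j + 1) * pi) = - 1" "cos ((2 * real j - 1) * pi) = - 1"
  using cos_npi[of "2 * j"] by (simp_all add: distrib_right left_diff_distrib cos_add cos_diff sin_npi
      mult.assoc cos_npi2 del: cos_npi)

context
  fixes k :: nat
  assumes k: "k > 0" and a_eq: "a = 1 / (2 * pi * k) ^ 4"
    and e_small: "e * ((12 * a + 3 * m) * (2 * pi * k)\<^sup>2 + 4 * m)\<^sup>2 \<le> 2"
begin

lemma u_peak:
  assumes "j < k"
  shows "u e (2 * pi * j, 0) > 1 / 2"
proof -
  have "(2 * pi * j) ^ 4 < (2 * pi * k) ^ 4"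
    using assms by (intro power_strict_mono) auto
  then have "a * (2 * pi * j) ^ 4 < 1"
    using k by (simp add: a_eq)
  moreover have "cos (2 * pi * j) = 1"
    using cos_npi2[of "2 * j"] by (simp add: algebra_simps)
  ultimately have "v (2 * pi * j, 0) > 0" by (simp add: v_def)
  then show ?thesis using e by (simp add: u_def)
qed

text \<open>The lines on both sides of the peak number j. The one on the left is at -pi for j = 0,
  and all of them satisfy |x| <= 2 pi k.\<close>

lemma u_valley:
  assumes "j < k" "\<bar>y\<bar> \<le> 2"
  shows "u e ((2 * real j + 1) * pi, y) \<le> 1 / 2" "u e ((2 * real j - 1) * pi, y) \<le> 1 / 2"
proof -
  have j: "2 * real j + 1 \<le> 2 * k" using assms(1) by simp
  have "\<bar>(2 * real j + 1) * pi\<bar> \<le> 2 * pi * k" "\<bar>(2 * real j - 1) * pi\<bar> \<le> 2 * pi * k"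
    using j mult_right_mono[OF j, of pi] mult_right_mono[of "\<bar>2 * real j - 1\<bar>" "2 * k" pi]
    by (auto simp: abs_mult mult_ac)
  then have "((2 * real j + 1) * pi)\<^sup>2 \<le> (2 * pi * k)\<^sup>2" "((2 * real j - 1) * pi)\<^sup>2 \<le> (2 * pi * k)\<^sup>2"
    using abs_le_square_iff by (metis abs_le_self_iff abs_of_nonneg order_trans abs_ge_zero)+
  from this[THEN u_separating_line[rotated, OF _ e_small assms(2)]] cos_odd_multiple_pi[of j]
  show "u e ((2 * real j + 1) * pi, y) \<le> 1 / 2" "u e ((2 * real j - 1) * pi, y) \<le> 1 / 2"
    by simp_all
qed

lemma peak_in_superlevel:
  "j < k \<Longrightarrow> (2 * pi * j, 0) \<in> {p \<in> \<Omega> e. u e p > 1 / 2}"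
  using u_peak[of j] by (simp add: \<Omega>_def)

lemma superlevel_nonempty: "{p \<in> \<Omega> e. u e p > 1 / 2} \<noteq> {}"
  using peak_in_superlevel[OF k] by blast

text \<open>The projection of a component to the x-axis is an interval. If it contained two peaks it
  would contain the odd multiple of pi between them, where \<open>u e\<close> does not exceed
  1/2.\<close>

lemma at_least_components: "at_least k (components {p \<in> \<Omega> e. u e p > 1 / 2})"
proof -
  let ?S = "{p \<in> \<Omega> e. u e p > 1 / 2}"
  define C where "C j = connected_component_set ?S (2 * pi * real j, 0)" for j :: nat
  have mem: "(2 * pi * real j, 0) \<in> C j" if "j < k" for j
    unfolding C_def using peak_in_superlevel[OF that] by (metis connected_component_refl mem_Collect_eq)
  have neq: "C i \<noteq> C j" if "i < j" "j < k" for i j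
  proof
    assume eq: "C i = C j"
    have conn: "connected (fst ` C i)"
      unfolding C_def by (intro connected_continuous_image continuous_intros connected_connected_component)
    have "2 * pi * real i \<in> fst ` C i" "2 * pi * real j \<in> fst ` C i"
      using mem[of i] mem[of j] that eq by force+
    moreover have "2 * pi * real i \<le> (2 * real i + 1) * pi" "(2 * real i + 1) * pi \<le> 2 * pi * real j"
    proof -
      have "2 * real i + 1 \<le> 2 * real j" using that by simp
      from mult_right_mono[OF this, of pi] show "(2 * real i + 1) * pi \<le> 2 * pi * real j"
        by (simp add: mult_ac)
    qed (simp add: algebra_simps)
    ultimately have "(2 * real i + 1) * pi \<in> fst ` C i"
      using conn unfolding connected_iff_interval by blast
    then obtain y where "((2 * real i + 1) * pi, y) \<in> C i" by auto
    then have "((2 * real i + 1) * pi, y) \<in> ?S"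
      using connected_component_subset unfolding C_def by blast
    then show False using u_valley(1)[of i y] that by (simp add: \<Omega>_def)
  qed
  have "inj_on C {..<k}"
    by (rule inj_onI) (metis lessThan_iff linorder_neqE_nat neq)
  then have "card (C ` {..<k}) = k" by (simp add: card_image)
  moreover have "C ` {..<k} \<subseteq> components ?S"
    using peak_in_superlevel by (auto simp: components_def C_def)
  ultimately show ?thesis
    unfolding at_least_def by (intro exI[of _ "C ` {..<k}"]) simp
qed

text \<open>The maximum over the closed rectangle between two separating lines exceeds 1/2 by the
  peak inside. It is therefore attained off the vertical sides, and also off the horizontal ones,
  where \<open>u e\<close> is negative; so it is a local maximum.\<close>

lemma at_least_max_points: "at_least k (max_points (\<Omega> e) (u e))"
proof -
  have "\<exists>q. q \<in> max_points (\<Omega> e) (u e) \<and> \<bar>fst q - 2 * pi * j\<bar> < pi" if j: "j < k" for j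
  proof -
    let ?R = "{(2 * real j - 1) * pi .. (2 * real j + 1) * pi} \<times> {-2..2::real}"
    have pk: "(2 * pi * j, 0) \<in> ?R" by (simp add: algebra_simps)
    have "compact ?R" by (intro compact_Times compact_Icc)
    from continuous_attains_sup[OF this _ analytic_expr_continuous[OF analytic_expr_u(1)], of e] pk
    obtain q where q: "q \<in> ?R" "\<And>p. p \<in> ?R \<Longrightarrow> u e p \<le> u e q" by blast
    obtain x y where xy: "q = (x, y)" by fastforce
    have uq: "u e q > 1 / 2" using q(2)[OF pk] u_peak[OF j] by simp
    have x: "(2 * real j - 1) * pi < x" "x < (2 * real j + 1) * pi" and y: "\<bar>y\<bar> < 2"
      using q(1) uq u_valley[OF j, of y] nonneg_bounds(3)[of q] unfolding xy
      by (auto simp: less_le abs_le_iff)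
    let ?N = "{(2 * real j - 1) * pi <..< (2 * real j + 1) * pi} \<times> {-2<..<2::real}"
    have "open ?N" by (intro open_Times open_greaterThanLessThan)
    moreover have "q \<in> ?N" using x y by (auto simp: xy)
    moreover have "u e p \<le> u e q" if "p \<in> ?N" for p
      using q(2)[of p] that by auto
    ultimately have "\<forall>\<^sub>F p in nhds q. p \<in> \<Omega> e \<longrightarrow> u e p \<le> u e q"
      unfolding eventually_nhds by blast
    then have "q \<in> max_points (\<Omega> e) (u e)"
      using uq y by (simp add: max_points_def \<Omega>_def xy)
    moreover have "\<bar>fst q - 2 * pi * j\<bar> < pi"
      using x by (simp add: xy abs_less_iff algebra_simps)
    ultimately show ?thesis by blast
  qed
  then obtain q where q: "\<And>j. j < k \<Longrightarrow> q j \<in> max_points (\<Omega> e) (u e)"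
    "\<And>j. j < k \<Longrightarrow> \<bar>fst (q j) - 2 * pi * real j\<bar> < pi" by metis
  have neq: "q i \<noteq> q j" if "i < j" "j < k" for i j
  proof
    assume "q i = q j"
    then have "2 * pi * real j - 2 * pi * real i < 2 * pi"
      using q(2)[of i] q(2)[of j] that by (auto simp: abs_less_iff)
    then have "2 * pi * (real j - real i) < 2 * pi * 1" by (simp add: algebra_simps)
    then have "real j - real i < 1" by (subst (asm) mult_less_cancel_left_pos) auto
    then show False using that by linarith
  qed
  have "inj_on q {..<k}"
    by (rule inj_onI) (metis lessThan_iff linorder_neqE_nat neq)
  then have "card (q ` {..<k}) = k" by (simp add: card_image)
  then show ?thesis
    unfolding at_least_def using q(1) by (intro exI[of _ "q ` {..<k}"]) auto
qed

end

end

section \<open>Inflection points of the boundary\<close>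

text \<open>A common constant reduces the smallness conditions in the central region to conditions
  on e M and e M^2. Both bounds survive enlarging the constant, so the induction can take
  maxima.\<close>

lemma analytic_expr_uniform_bound:
  assumes "finite F" "F \<subseteq> analytic_expr" "compact S" "convex S"
  shows "\<exists>M\<ge>1. \<forall>f\<in>F. \<forall>p\<in>S. \<bar>f p\<bar> \<le> M \<and>
    (\<forall>q\<in>S. \<bar>f p - f q\<bar> \<le> M * (\<bar>fst p - fst q\<bar> + \<bar>snd p - snd q\<bar>))"
proof -
  let ?d = "\<lambda>p q :: real \<times> real. \<bar>fst p - fst q\<bar> + \<bar>snd p - snd q\<bar>"
  define bdd where "bdd f M \<longleftrightarrow> (\<forall>p\<in>S. \<bar>f p\<bar> \<le> M \<and> (\<forall>q\<in>S. \<bar>f p - f q\<bar> \<le> M * ?d p q))"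
    for f :: "real \<times> real \<Rightarrow> real" and M
  have mono: "bdd f M'" if "bdd f M" "M \<le> M'" for f M M'
    unfolding bdd_def
  proof (intro ballI conjI)
    fix p q assume pq: "p \<in> S" "q \<in> S"
    have "M * ?d p q \<le> M' * ?d p q" using that(2) by (intro mult_right_mono) auto
    moreover have "\<bar>f p - f q\<bar> \<le> M * ?d p q" using that(1) pq unfolding bdd_def by blast
    ultimately show "\<bar>f p - f q\<bar> \<le> M' * ?d p q" by (rule order_trans[rotated])
  next
    fix p assume "p \<in> S"
    then have "\<bar>f p\<bar> \<le> M" using that(1) unfolding bdd_def by blast
    then show "\<bar>f p\<bar> \<le> M'" using that(2) by (rule order_trans)
  qed
  have ex: "\<exists>M. bdd f M" if f: "f \<in> analytic_expr" for f
  proof -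
    obtain C1 where C1: "\<forall>p\<in>S. \<bar>f p\<bar> \<le> C1" using analytic_expr_bounded[OF f assms(3)] by blast
    obtain C2 where C2: "\<forall>p\<in>S. \<forall>q\<in>S. \<bar>f p - f q\<bar> \<le> C2 * ?d p q"
      using analytic_expr_Lipschitz[OF f assms(3,4)] by blast
    have "C2 * ?d p q \<le> max C1 C2 * ?d p q" for p q by (intro mult_right_mono) auto
    then have "bdd f (max C1 C2)"
      unfolding bdd_def using C1 C2 by (meson max.coboundedI1 order_trans)
    then show ?thesis ..
  qed
  have "\<exists>M\<ge>1. \<forall>f\<in>F. bdd f M"
    using assms(1,2)
  proof induction
    case empty
    then show ?case by (intro exI[of _ 1]) simp
  next
    case (insert g F)
    then obtain M M' where "M \<ge> 1" "\<forall>f\<in>F. bdd f M" "bdd g M'" using ex[of g] by auto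
    then show ?case
      by (intro exI[of _ "max M M'"]) (auto intro: mono)
  qed
  then show ?thesis unfolding bdd_def .
qed

lemma abs_cos_diff_le: "\<bar>cos x - cos y\<bar> \<le> \<bar>x - y\<bar>" for x y :: real
proof -
  have "norm (cos x - cos y) \<le> 1 * norm (x - y)"
    by (rule field_differentiable_bound[where S = UNIV and f' = "\<lambda>x. - sin x"])
      (auto intro!: derivative_eq_intros)
  then show ?thesis by simp
qed

context bumps
begin

text \<open>The curvature numerator of \<open>u e\<close> is \<open>e\<close> times \<open>inflection e\<close>, whose expansion in powers of
  \<open>e\<close> on the boundary has the leading term \<open>v\<^sub>y\<^sub>y y\<^sup>2\<close>.\<close>

definition inflection :: "real \<Rightarrow> real \<times> real \<Rightarrow> real" where
  "inflection e p = vyy p * uy e p ^ 2 + 2 * e * vxy p * vx p * uy e p + e * (1 - e * vyy p) * vx p ^ 2"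

definition inflection0 where "inflection0 p = vyy p * snd p ^ 2"
definition inflection1 where
  "inflection1 p = vx p ^ 2 - 2 * vyy p * snd p * vy p - 2 * vxy p * vx p * snd p"
definition inflection2 where
  "inflection2 p = vyy p * vy p ^ 2 - vyy p * vx p ^ 2 + 2 * vxy p * vx p * vy p"

text \<open>The expansion is exact and stops at order two, so bounding three functions independent
  of \<open>e\<close> controls \<open>inflection e\<close> on the box for all e <= 1.\<close>

lemma inflection_expand:
  "inflection e p = inflection0 p + e * (inflection1 p + e * inflection2 p)"
  unfolding inflection_def inflection0_def inflection1_def inflection2_def uy_def by algebra

lemma analytic_expr_inflection:
  "inflection0 \<in> analytic_expr" "inflection1 \<in> analytic_expr" "inflection2 \<in> analytic_expr"
  unfolding inflection0_def[abs_def] inflection1_def[abs_def] inflection2_def[abs_def]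
  by (intro analytic_expr_intros analytic_expr_v)+

lemma analytic_expr_inflection_e: "inflection e \<in> analytic_expr"
  unfolding inflection_expand[abs_def] by (intro analytic_expr_intros analytic_expr_inflection)

text \<open>Only the symmetry in y is broken by the tilt. Evenness in x reduces the search for
  inflections to x > 0 and makes them occur in pairs.\<close>

lemma reflect_x:
  "u e (- x, y) = u e (x, y)" "inflection e (- x, y) = inflection e (x, y)"
  by (simp_all add: u_def v_def inflection_def vyy_def uy_def vy_def vxy_def vx_def)
    algebra

definition coefficients :: "(real \<times> real \<Rightarrow> real) set" where
  "coefficients = {v, vy, vxy, vyy, inflection0, inflection1, inflection2}"

lemma u_zero_iff: "u e p = 0 \<longleftrightarrow> snd p ^ 2 = 1 + 2 * (e * v p)"
  unfolding u_def by (auto simp: field_simps)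

lemma coefficients_analytic: "finite coefficients" "coefficients \<subseteq> analytic_expr"
  by (auto simp: coefficients_def analytic_expr_v analytic_expr_inflection)

end

section \<open>Sign of the curvature\<close>

context perturbed_strip
begin

lemma Curv_inflection:
  "p \<in> frontier (\<Omega> e) \<Longrightarrow> Curv (\<Omega> e) p = e * inflection e p / norm (ux e p, uy e p) ^ 3"
  unfolding level.Curv_eq level.level_curvature_def level.curvature_numerator_def
  by (simp add: inflection_def ux_def uxx_def uxy_def uyy_def algebra_simps power2_eq_square)

lemma norm_gradient_pos: "p \<in> frontier (\<Omega> e) \<Longrightarrow> norm (ux e p, uy e p) > 0"
  using regular_u[of p] by (simp add: frontier_\<Omega> zero_prod_def)

lemma Curv_sign:
  assumes "p \<in> frontier (\<Omega> e)"
  shows "Curv (\<Omega> e) p > 0 \<longleftrightarrow> inflection e p > 0" "Curv (\<Omega> e) p < 0 \<longleftrightarrow> inflection e p < 0"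
    "Curv (\<Omega> e) p = 0 \<longleftrightarrow> inflection e p = 0"
proof -
  have "norm (ux e p, uy e p) ^ 3 > 0" using norm_gradient_pos[OF assms] by (rule zero_less_power)
  then show "Curv (\<Omega> e) p > 0 \<longleftrightarrow> inflection e p > 0" "Curv (\<Omega> e) p < 0 \<longleftrightarrow> inflection e p < 0"
    "Curv (\<Omega> e) p = 0 \<longleftrightarrow> inflection e p = 0"
    unfolding Curv_inflection[OF assms] using e
    by (auto simp: zero_less_divide_iff divide_less_0_iff zero_less_mult_iff mult_less_0_iff)
qed

text \<open>\<open>inflection e p\<close> is a quadratic form in (\<open>uy e p\<close>,
  \<open>vx p\<close>), and this vector is nonzero on the boundary. The two hypotheses make the form
  positive definite; no expansion in \<open>e\<close> is involved, so the criterion remains usable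
  where v is large.\<close>

lemma inflection_pos:
  assumes "p \<in> frontier (\<Omega> e)" "e * vyy p \<le> 1 / 2" "2 * e * vxy p ^ 2 < vyy p"
  shows "inflection e p > 0"
proof -
  define A w s t where "A = vyy p" and "w = vxy p" and "s = uy e p" and "t = vx p"
  have A: "A > 0" using assms(3) e by (smt (verit) A_def mult_nonneg_nonneg zero_le_power2)
  have w: "A - 2 * e * w\<^sup>2 > 0" using assms(3) by (simp add: A_def w_def)
  have st: "s \<noteq> 0 \<or> t \<noteq> 0" using regular_u[of p] assms(1) by (auto simp: frontier_\<Omega> s_def t_def ux_def)
  have "A * inflection e p = (A * s + e * w * t)\<^sup>2 + e * t\<^sup>2 / 2 * (A - 2 * e * w\<^sup>2)
      + A * e * t\<^sup>2 * (1 / 2 - e * A)"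
    by (simp add: inflection_def A_def w_def s_def t_def field_simps power2_eq_square)
  moreover have "A * e * t\<^sup>2 * (1 / 2 - e * A) \<ge> 0" using A e assms(2) by (simp add: A_def)
  moreover have "(A * s + e * w * t)\<^sup>2 + e * t\<^sup>2 / 2 * (A - 2 * e * w\<^sup>2) > 0"
  proof (cases "t = 0")
    case True
    then show ?thesis using A st by simp
  next
    case False
    then show ?thesis using w e by (intro add_nonneg_pos mult_pos_pos) auto
  qed
  ultimately have "A * inflection e p > 0" by linarith
  then show ?thesis using A by (simp add: zero_less_mult_iff)
qed

end

text \<open>The upper boundary has negative curvature for \<open>\<bar>x\<bar> \<le> L0\<close> and positive curvature for
  \<open>\<bar>x\<bar> \<ge> L1\<close>; the two thresholds do not depend on \<open>e\<close>.\<close>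

locale two_inflections = perturbed_strip +
  fixes L0 L1 M :: real
  assumes L0: "L0 > 0" "24 * a * L0 \<ge> cosh 2 + 2"
    and m_large: "3 * m \<ge> cosh 2 + 12 * a * L0\<^sup>2 + 1" "3 * m \<ge> cosh 2 + 48 * a + 1"
    and L1: "L1 \<ge> L0" "L1 \<ge> 1" "6 * a * L1\<^sup>2 \<ge> cosh 2 + 48 * a + 12 * m"
    and M: "M \<ge> 1"
      "f \<in> coefficients \<Longrightarrow> p \<in> {-L1..L1} \<times> {-2..2} \<Longrightarrow> \<bar>f p\<bar> \<le> M"
      "f \<in> coefficients \<Longrightarrow> p \<in> {-L1..L1} \<times> {-2..2} \<Longrightarrow> q \<in> {-L1..L1} \<times> {-2..2} \<Longrightarrow>
        \<bar>f p - f q\<bar> \<le> M * (\<bar>fst p - fst q\<bar> + \<bar>snd p - snd q\<bar>)"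
    and e_near: "e \<le> 1" "64 * e * M\<^sup>2 \<le> 1"
    and e_far: "2 * e * (cosh 2 + 48 * a + 6 * m)\<^sup>2 < 6 * a" "8 * e * (cosh 2 + 12 * a + 12 * m)\<^sup>2 \<le> a"
begin

lemma eM: "64 * (e * M) \<le> 1"
proof -
  have "e * M * 1 \<le> e * M * M" using M(1) e by (intro mult_left_mono) auto
  then show ?thesis using e_near(2) by (simp add: power2_eq_square)
qed

lemma bound_trig:
  assumes "\<bar>y\<bar> \<le> 2"
  shows "\<bar>cos x * cosh y\<bar> \<le> cosh 2" "\<bar>sin x * sinh y\<bar> \<le> cosh (2::real)"
  using cosh_le_cosh[OF assms] abs_sinh_le_cosh[of y] by (auto intro!: abs_mult_bounded)

text \<open>Far out, v_yy lies between positive multiples of x^2 while v_xy is O(x), so 2 e v_xy^2 <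
  v_yy for small \<open>e\<close>. That e v_yy stays below 1/2 needs the bound on the extent of the
  domain.\<close>

lemma far_inflection_pos:
  assumes p: "p \<in> frontier (\<Omega> e)" and x: "\<bar>fst p\<bar> \<ge> L1"
  shows "inflection e p > 0"
proof -
  obtain x y where xy: "p = (x, y)" by fastforce
  have y: "\<bar>y\<bar> \<le> 2" and u0: "u e (x, y) = 0" using p by (auto simp: frontier_\<Omega> xy)
  have x1: "\<bar>x\<bar> \<ge> 1" using x L1 by (simp add: xy)
  have y2: "y\<^sup>2 \<le> 4" using y abs_le_square_iff[of y 2] by simp
  have x2: "x\<^sup>2 \<ge> L1\<^sup>2" using x L1 abs_le_square_iff[of L1 x] by (simp add: xy)
  have x21: "x\<^sup>2 \<ge> 1" using x1 abs_le_square_iff[of 1 x] by simp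
  define T T' where "T = cosh 2 + 48 * a + 6 * m" and "T' = cosh 2 + 12 * a + 12 * m"
  have T: "T > 0" "T' > 0" using a m by (simp_all add: T_def T'_def add_pos_pos)
  have ax: "6 * a * x\<^sup>2 \<ge> cosh 2 + 48 * a + 12 * m"
    using L1(3) mult_left_mono[OF x2, of "6 * a"] a by linarith
  have ay: "a * y\<^sup>2 \<le> a * 4" "a * y\<^sup>2 \<ge> 0" using y2 a by simp_all
  have my: "\<bar>m * y\<bar> \<le> 2 * m" using mult_left_mono[OF y, of m] m by (simp add: abs_mult)
  have A1: "vyy p \<ge> 6 * a * x\<^sup>2"
    using bound_trig(1)[OF y, of x] ax ay my by (simp add: vyy_def xy algebra_simps)
  have "vyy p \<le> cosh 2 + 12 * (a * x\<^sup>2) + 12 * m"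
    using bound_trig(1)[OF y, of x] ay my by (simp add: vyy_def xy algebra_simps)
  also have "\<dots> \<le> T' * x\<^sup>2"
  proof -
    have "cosh 2 * 1 \<le> cosh 2 * x\<^sup>2" "12 * m * 1 \<le> 12 * m * x\<^sup>2"
      using x21 m by (intro mult_left_mono; simp)+
    then show ?thesis unfolding T'_def distrib_right by linarith
  qed
  finally have A2: "vyy p \<le> T' * x\<^sup>2" .
  have w: "\<bar>vxy p\<bar> \<le> T * \<bar>x\<bar>"
  proof -
    have "\<bar>x * y\<bar> \<le> \<bar>x\<bar> * 2" unfolding abs_mult using y by (intro mult_left_mono) auto
    from mult_left_mono[OF this, of "24 * a"] a have "\<bar>24 * a * x * y\<bar> \<le> 48 * a * \<bar>x\<bar>"
      by (simp add: abs_mult mult_ac)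
    moreover have "\<bar>6 * m * x\<bar> = 6 * m * \<bar>x\<bar>" using m by (simp add: abs_mult)
    moreover have "cosh 2 * 1 \<le> cosh 2 * \<bar>x\<bar>" using x1 by (intro mult_left_mono) auto
    ultimately show ?thesis
      using bound_trig(2)[OF y, of x] unfolding vxy_def T_def xy fst_conv snd_conv distrib_right
      by linarith
  qed
  have w2: "vxy p ^ 2 \<le> T\<^sup>2 * x\<^sup>2"
    using power_mono[OF w, of 2] by (simp add: power_mult_distrib)
  have "2 * e * vxy p ^ 2 \<le> 2 * e * (T\<^sup>2 * x\<^sup>2)" using w2 e by simp
  also have "\<dots> = 2 * e * T\<^sup>2 * x\<^sup>2" by simp
  also have "\<dots> < 6 * a * x\<^sup>2"
    using e_far(1) x21 unfolding T_def by (intro mult_strict_right_mono) auto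
  also note A1
  finally have 1: "2 * e * vxy p ^ 2 < vyy p" .
  \<comment> \<open>On the boundary e a x^4 <= 2, hence e x^2 is O(sqrt e) even though |x| is not
    bounded uniformly in \<open>e\<close>.\<close>
  have "(e * (T' * x\<^sup>2))\<^sup>2 * a = e * T'\<^sup>2 * (e * a * x ^ 4)"
    by (simp add: power_mult_distrib) algebra
  also have "\<dots> \<le> e * T'\<^sup>2 * 2"
    using nonneg_bounds(1)[of p] y u0 e by (intro mult_left_mono) (auto simp: xy)
  also have "\<dots> \<le> (1 / 2)\<^sup>2 * a" using e_far(2) by (simp add: T'_def power2_eq_square field_simps)
  finally have "(e * (T' * x\<^sup>2))\<^sup>2 \<le> (1 / 2)\<^sup>2" using a by simp
  then have "e * (T' * x\<^sup>2) \<le> 1 / 2" by (rule power2_le_imp_le) simp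
  then have 2: "e * vyy p \<le> 1 / 2" using mult_left_mono[OF A2, of e] e by linarith
  show ?thesis by (rule inflection_pos[OF p 2 1])
qed

text \<open>On the boundary y^2 = 1 + 2 e v with |e v| <= 1/64, so over the central interval the
  boundary falls into an upper and a lower arc.\<close>

lemma near_boundary:
  assumes "p \<in> frontier (\<Omega> e)" "\<bar>fst p\<bar> \<le> L1"
  shows "p \<in> {-L1..L1} \<times> {-2..2}" "\<bar>snd p\<bar> \<ge> 1 / 2"
proof -
  show B: "p \<in> {-L1..L1} \<times> {-2..2}"
    using assms by (auto simp: frontier_\<Omega> mem_Times_iff abs_le_iff)
  have "\<bar>v p\<bar> \<le> M" by (rule M(2)[OF _ B]) (simp add: coefficients_def)
  then have "\<bar>e * v p\<bar> \<le> e * M" using e by (simp add: abs_mult)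
  moreover have "snd p ^ 2 = 1 + 2 * (e * v p)" using assms(1) u_zero_iff by (simp add: frontier_\<Omega>)
  ultimately have "snd p ^ 2 \<ge> (1 / 2)\<^sup>2" using eM by (simp add: power2_eq_square abs_le_iff)
  then show "\<bar>snd p\<bar> \<ge> 1 / 2" using abs_le_square_iff[of "1 / 2" "snd p"] by simp
qed

text \<open>For y <= -1/2 the tilt contributes at least 3 m to v_yy, which beats the cosine term and
  the -48 a from the quartic.\<close>

lemma bottom_inflection_pos:
  assumes p: "p \<in> frontier (\<Omega> e)" and x: "\<bar>fst p\<bar> \<le> L1" and y: "snd p < 0"
  shows "inflection e p > 0"
proof -
  note B = near_boundary(1)[OF p x]
  have y': "snd p \<le> - 1 / 2" "\<bar>snd p\<bar> \<le> 2" using near_boundary[OF p x] y by (auto simp: mem_Times_iff)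
  have y2: "snd p ^ 2 \<le> 4" using y' abs_le_square_iff[of "snd p" 2] by simp
  have "a * (fst p ^ 2 - snd p ^ 2) \<ge> a * (- 4)"
    using a y2 zero_le_power2[of "fst p"] by (intro mult_left_mono) linarith+
  moreover have "m * snd p \<le> m * (- 1 / 2)" using m y' by (intro mult_left_mono) auto
  ultimately have A: "vyy p \<ge> 1"
    using bound_trig(1)[OF y'(2), of "fst p"] m_large(2) by (simp add: vyy_def)
  have "\<bar>vyy p\<bar> \<le> M" "\<bar>vxy p\<bar> \<le> M" by (rule M(2)[OF _ B]; simp add: coefficients_def)+
  then have "e * vyy p \<le> e * M" "2 * e * vxy p ^ 2 \<le> 2 * e * M\<^sup>2"
    using e power_mono[of "\<bar>vxy p\<bar>" M 2] by simp_all
  then show ?thesis using inflection_pos[OF p] eM e_near(2) A by linarith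
qed

lemma inflection_perturbation:
  assumes "p \<in> {-L1..L1} \<times> {-2..2}"
  shows "\<bar>inflection e p - inflection0 p\<bar> \<le> 2 * (e * M)"
proof -
  have "\<bar>inflection1 p\<bar> \<le> M" "\<bar>inflection2 p\<bar> \<le> M" by (rule M(2)[OF _ assms]; simp add: coefficients_def)+
  moreover from this have "\<bar>e * inflection2 p\<bar> \<le> M" using e e_near by (intro abs_mult_bounded) auto
  ultimately have "\<bar>inflection1 p + e * inflection2 p\<bar> \<le> 2 * M" by linarith
  from mult_left_mono[OF this, of e] show ?thesis using e by (simp add: inflection_expand abs_mult)
qed

text \<open>For y >= 1/2 the tilt contributes at most -3 m to v_yy, against a quartic term of at
  most 12 a L0^2. The leading term is then at most -1/4 and the corrections at most 1/32.\<close>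

lemma top_inflection_neg:
  assumes p: "p \<in> frontier (\<Omega> e)" and x: "\<bar>fst p\<bar> \<le> L0" and y: "snd p > 0"
  shows "inflection e p < 0"
proof -
  have x': "\<bar>fst p\<bar> \<le> L1" using x L1 by simp
  note B = near_boundary(1)[OF p x']
  have y': "snd p \<ge> 1 / 2" "\<bar>snd p\<bar> \<le> 2" using near_boundary[OF p x'] y by (auto simp: mem_Times_iff)
  have "fst p ^ 2 \<le> L0\<^sup>2" using x L0 abs_le_square_iff[of "fst p" L0] by simp
  then have "a * (fst p ^ 2 - snd p ^ 2) \<le> a * L0\<^sup>2"
    using a zero_le_power2[of "snd p"] by (intro mult_left_mono) linarith+
  moreover have "m * snd p \<ge> m * (1 / 2)" using m y' by (intro mult_left_mono) auto
  ultimately have A: "vyy p \<le> - 1"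
    using bound_trig(1)[OF y'(2), of "fst p"] m_large(1) by (simp add: vyy_def)
  have "snd p ^ 2 \<ge> (1 / 2)\<^sup>2" using y' by (intro power_mono) auto
  then have "vyy p * snd p ^ 2 \<le> - 1 * (1 / 2)\<^sup>2"
    using mult_mono[of 1 "- vyy p" "(1 / 2)\<^sup>2" "snd p ^ 2"] A by simp
  then show ?thesis
    using inflection_perturbation[OF B] eM by (simp add: inflection0_def power2_eq_square)
qed

text \<open>Subtract the equations y^2 = 1 + 2 e v at the two points and divide by the sum of the
  heights, which is at least 1. The dependence of v on y returns at most half of the left side and
  is absorbed. At equal abscissas this says that the upper arc is a graph.\<close>

lemma boundary_Lipschitz:
  assumes p: "p \<in> {-L1..L1} \<times> {1/2..2}" "u e p = 0" and q: "q \<in> {-L1..L1} \<times> {1/2..2}" "u e q = 0"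
  shows "\<bar>snd p - snd q\<bar> \<le> 4 * (e * M) * \<bar>fst p - fst q\<bar>"
proof -
  have B: "p \<in> {-L1..L1} \<times> {-2..2}" "q \<in> {-L1..L1} \<times> {-2..2}" using p q by (auto simp: mem_Times_iff)
  have "\<bar>v p - v q\<bar> \<le> M * (\<bar>fst p - fst q\<bar> + \<bar>snd p - snd q\<bar>)"
    by (rule M(3)[OF _ B]) (simp add: coefficients_def)
  from mult_left_mono[OF this, of e] e
  have 1: "e * \<bar>v p - v q\<bar> \<le> e * M * (\<bar>fst p - fst q\<bar> + \<bar>snd p - snd q\<bar>)" by (simp add: mult.assoc)
  have "snd p ^ 2 - snd q ^ 2 = 2 * (e * (v p - v q))"
    using p(2) q(2) by (simp add: u_zero_iff algebra_simps)
  then have "(snd p - snd q) * (snd p + snd q) = 2 * (e * (v p - v q))"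
    by (simp add: power2_eq_square algebra_simps)
  then have "\<bar>snd p - snd q\<bar> * \<bar>snd p + snd q\<bar> = 2 * (e * \<bar>v p - v q\<bar>)"
    using e by (metis abs_mult abs_numeral abs_of_pos)
  moreover have "\<bar>snd p - snd q\<bar> * 1 \<le> \<bar>snd p - snd q\<bar> * \<bar>snd p + snd q\<bar>"
    using p q by (intro mult_left_mono) (auto simp: mem_Times_iff)
  ultimately have "\<bar>snd p - snd q\<bar> \<le> 2 * (e * M * \<bar>fst p - fst q\<bar>) + 2 * (e * M * \<bar>snd p - snd q\<bar>)"
    using 1 by (simp add: distrib_left)
  moreover have "e * M * \<bar>snd p - snd q\<bar> \<le> 1 / 4 * \<bar>snd p - snd q\<bar>"
    using eM by (intro mult_right_mono) auto
  moreover have "t \<le> 4 * (e * M) * s" if "t \<le> 2 * (e * M * s) + 2 * (e * M * t)" "e * M * t \<le> 1 / 4 * t"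
    for s t using that by (simp add: mult.assoc)
  ultimately show ?thesis by blast
qed

text \<open>Passing from p to q through the corner \<open>r\<close> separates the horizontal gain in
  the leading term, at least d/2, from the vertical loss and the higher order terms, each at most
  d/16.\<close>

lemma inflection_strict_mono:
  assumes p: "p \<in> {L0..L1} \<times> {1/2..2}" "u e p = 0" and q: "q \<in> {L0..L1} \<times> {1/2..2}" "u e q = 0"
    and less: "fst p < fst q"
  shows "inflection e p < inflection e q"
proof -
  define d where "d = fst q - fst p"
  have d: "d > 0" using less by (simp add: d_def)
  define r where "r = (fst q, snd p)"
  have B: "p \<in> {-L1..L1} \<times> {-2..2}" "q \<in> {-L1..L1} \<times> {-2..2}" "r \<in> {-L1..L1} \<times> {-2..2}"
    using p q L0 by (auto simp: mem_Times_iff r_def)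
  have dy: "\<bar>snd q - snd p\<bar> \<le> 4 * (e * M) * d"
    using boundary_Lipschitz[of q p] p q L0 d by (auto simp: mem_Times_iff d_def)
  \<comment> \<open>The tilt cancels in this difference at equal heights. By the choice of
    \<open>L0\<close> the quartic gives at least (cosh 2 + 2) d, of which the cosine can consume
    cosh 2 times d.\<close>
  have 1: "inflection0 r - inflection0 p \<ge> d / 2"
  proof -
    have "cosh (snd p) * \<bar>cos (fst q) - cos (fst p)\<bar> \<le> cosh 2 * d"
      using abs_cos_diff_le[of "fst q" "fst p"] cosh_le_cosh[of "snd p" 2] p d
      by (intro mult_mono) (auto simp: d_def mem_Times_iff)
    then have "\<bar>(cos (fst q) - cos (fst p)) * cosh (snd p)\<bar> \<le> cosh 2 * d"
      by (simp add: abs_mult mult.commute)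
    moreover have "12 * a * (fst q + fst p) * d \<ge> 12 * a * (2 * L0) * d"
      using p q a d by (intro mult_right_mono mult_left_mono) (auto simp: mem_Times_iff)
    moreover have "(24 * a * L0) * d \<ge> (cosh 2 + 2) * d" using L0(2) d by (intro mult_right_mono) auto
    moreover have "vyy r - vyy p = (cos (fst q) - cos (fst p)) * cosh (snd p) + 12 * a * (fst q + fst p) * d"
      by (simp add: vyy_def r_def d_def power2_eq_square algebra_simps)
    ultimately have "vyy r - vyy p \<ge> 2 * d" by (simp add: algebra_simps abs_le_iff)
    moreover have "snd p ^ 2 \<ge> (1 / 2)\<^sup>2" using p by (intro power_mono) (auto simp: mem_Times_iff)
    ultimately have "(vyy r - vyy p) * snd p ^ 2 \<ge> (2 * d) * (1 / 2)\<^sup>2" using d by (intro mult_mono) auto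
    then show ?thesis by (simp add: inflection0_def r_def power2_eq_square algebra_simps)
  qed
  have 2: "\<bar>inflection0 r - inflection0 q\<bar> \<le> M * (4 * (e * M) * d)"
  proof -
    have "\<bar>inflection0 r - inflection0 q\<bar> \<le> M * (\<bar>fst r - fst q\<bar> + \<bar>snd r - snd q\<bar>)"
      by (rule M(3)[OF _ B(3,2)]) (simp add: coefficients_def)
    also have "\<dots> \<le> M * (4 * (e * M) * d)"
      using dy M(1) by (intro mult_left_mono) (auto simp: r_def abs_minus_commute)
    finally show ?thesis .
  qed
  let ?l = "M * (\<bar>fst q - fst p\<bar> + \<bar>snd q - snd p\<bar>)"
  have l: "?l \<le> M * (2 * d)"
  proof -
    have "4 * (e * M) * d \<le> 1 * d" using eM d by (intro mult_right_mono) auto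
    then have "\<bar>fst q - fst p\<bar> + \<bar>snd q - snd p\<bar> \<le> 2 * d" using dy d abs_of_pos[OF d] by (simp only: d_def[symmetric])
    then show ?thesis using M(1) by (intro mult_left_mono) auto
  qed
  have "\<bar>inflection1 q - inflection1 p\<bar> \<le> ?l" "\<bar>inflection2 q - inflection2 p\<bar> \<le> ?l"
    by (rule M(3)[OF _ B(2,1)]; simp add: coefficients_def)+
  moreover from this have "\<bar>e * (inflection2 q - inflection2 p)\<bar> \<le> ?l"
    using e e_near by (intro abs_mult_bounded) auto
  ultimately have "\<bar>(inflection1 q - inflection1 p) + e * (inflection2 q - inflection2 p)\<bar> \<le> 4 * (M * d)"
    using l by linarith
  from mult_left_mono[OF this, of e] e
  have 3: "\<bar>e * ((inflection1 q - inflection1 p) + e * (inflection2 q - inflection2 p))\<bar> \<le> 4 * (e * M * d)"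
    by (simp add: abs_mult mult_ac)
  have 4: "64 * (e * M * d) \<le> d" "64 * (e * M\<^sup>2 * d) \<le> d"
    using mult_right_mono[OF eM, of d] mult_right_mono[OF e_near(2), of d] d by (simp_all add: mult.assoc)
  have "inflection e q - inflection e p = (inflection0 r - inflection0 p) - (inflection0 r - inflection0 q)
      + e * ((inflection1 q - inflection1 p) + e * (inflection2 q - inflection2 p))"
    by (simp add: inflection_expand algebra_simps)
  moreover have "M * (4 * (e * M) * d) = 4 * (e * M\<^sup>2 * d)" by (simp add: power2_eq_square)
  ultimately have "inflection e q - inflection e p \<ge> d / 2 - 4 * (e * M\<^sup>2 * d) - 4 * (e * M * d)"
    using 1 2 3 by linarith
  moreover have "d / 2 - 4 * (e * M\<^sup>2 * d) - 4 * (e * M * d) > 0" using 4 d by linarith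
  ultimately show ?thesis by linarith
qed

text \<open>\<open>s\<close> selects the upper or the lower arc. At height 1/2 the profile is 3/8
  and dominates the perturbation, and at height 2 \<open>u e\<close> is not positive.\<close>

lemma boundary_point_above:
  assumes "\<bar>x\<bar> \<le> L1" and s: "s = 1 \<or> s = - 1"
  shows "\<exists>y\<in>{1/2..2}. u e (x, s * y) = 0"
proof -
  have "(x, s / 2) \<in> {-L1..L1} \<times> {-2..2}" using assms by auto
  from M(2)[OF _ this, of v] have "\<bar>v (x, s / 2)\<bar> \<le> M" by (simp add: coefficients_def)
  then have "\<bar>e * v (x, s / 2)\<bar> \<le> e * M" using e by (simp add: abs_mult)
  moreover have "s\<^sup>2 = 1" using s by auto
  ultimately have 1: "u e (x, s * (1 / 2)) \<ge> 0"
    using eM by (simp add: u_def power_divide abs_le_iff)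
  have 2: "u e (x, s * 2) \<le> 0"
    using nonneg_bounds(3)[of "(x, s * 2)"] s by force
  have "continuous_on {1/2..2} (\<lambda>y. u e (x, s * y))"
    by (rule continuous_on_compose2[OF analytic_expr_continuous[OF analytic_expr_u(1), of UNIV]])
      (auto intro!: continuous_intros)
  from IVT2'[of "\<lambda>y. u e (x, s * y)" 2 0 "1/2", OF 2 1 _ this] show ?thesis by auto
qed

lemma frontier_iff_top:
  assumes "p \<in> {-L1..L1} \<times> {1/2..2}"
  shows "p \<in> frontier (\<Omega> e) \<longleftrightarrow> u e p = 0"
  using assms nonneg_bounds(3)[of p] by (auto simp: frontier_\<Omega> mem_Times_iff)

lemma unique_inflection:
  obtains p0 where "p0 \<in> {L0<..<L1} \<times> {1/2..2}" "u e p0 = 0" "inflection e p0 = 0"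
    "\<And>q. q \<in> {L0..L1} \<times> {1/2..2} \<Longrightarrow> u e q = 0 \<Longrightarrow> inflection e q = 0 \<Longrightarrow> q = p0"
proof -
  have "\<exists>y\<in>{1/2..2}. u e (x, y) = 0" if "x \<in> {L0..L1}" for x
    using boundary_point_above[of x 1] that L0 by auto
  \<comment> \<open>An arbitrary choice of heights; it is continuous because any two points of the
    upper arc obey the Lipschitz estimate.\<close>
  then obtain Y where Y: "\<And>x. x \<in> {L0..L1} \<Longrightarrow> Y x \<in> {1/2..2} \<and> u e (x, Y x) = 0" by metis
  have lip: "\<bar>Y x - Y x'\<bar> \<le> 4 * (e * M) * \<bar>x - x'\<bar>" if "x \<in> {L0..L1}" "x' \<in> {L0..L1}" for x x'
    using boundary_Lipschitz[of "(x, Y x)" "(x', Y x')"] Y[OF that(1)] Y[OF that(2)] that L0 by simp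
  have "(4 * (e * M))-lipschitz_on {L0..L1} Y"
    using lip e M(1) by (intro lipschitz_onI) (auto simp: dist_real_def)
  then have contY: "continuous_on {L0..L1} Y" by (rule lipschitz_on_continuous_on)
  have cont: "continuous_on {L0..L1} (\<lambda>x. inflection e (x, Y x))"
    by (rule continuous_on_compose2[OF analytic_expr_continuous[OF analytic_expr_inflection_e, of UNIV]])
      (auto intro!: continuous_intros contY)
  have fr: "(x, Y x) \<in> frontier (\<Omega> e)" if "x \<in> {L0..L1}" for x
    using frontier_iff_top[of "(x, Y x)"] Y[OF that] that L0 by auto
  have ends: "L0 \<in> {L0..L1}" "L1 \<in> {L0..L1}" using L1 by auto
  have neg: "inflection e (L0, Y L0) < 0"
    using top_inflection_neg[OF fr[OF ends(1)]] Y[OF ends(1)] L0 by auto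
  have pos: "inflection e (L1, Y L1) > 0"
    using far_inflection_pos[OF fr[OF ends(2)]] L1 by auto
  obtain x0 where x0: "x0 \<in> {L0..L1}" "inflection e (x0, Y x0) = 0"
    using IVT'[of "\<lambda>x. inflection e (x, Y x)" L0 0 L1, OF _ _ L1(1) cont] neg pos by auto
  have "x0 \<noteq> L0" "x0 \<noteq> L1" using x0 neg pos by auto
  moreover have "q = (x0, Y x0)"
    if q: "q \<in> {L0..L1} \<times> {1/2..2}" "u e q = 0" "inflection e q = 0" for q
  proof -
    have p: "(x0, Y x0) \<in> {L0..L1} \<times> {1/2..2}" "u e (x0, Y x0) = 0" using Y[OF x0(1)] x0 by auto
    have fst: "fst q = x0"
      using inflection_strict_mono[OF p q(1,2)] inflection_strict_mono[OF q(1,2) p] q(3) x0(2) by force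
    have "\<bar>snd q - Y x0\<bar> \<le> 4 * (e * M) * \<bar>fst q - x0\<bar>"
      using boundary_Lipschitz[of q "(x0, Y x0)"] p q L0 by (auto simp: mem_Times_iff)
    then show ?thesis using fst by (simp add: prod_eq_iff)
  qed
  ultimately show ?thesis using that[of "(x0, Y x0)"] x0 Y[OF x0(1)] by auto
qed

text \<open>The sign lemmas leave only the upper arc with L0 < |x| < L1, where reflection reduces to
  the unique zero. The two mirror images differ because L0 > 0.\<close>

lemma card_zero_curvature: "card {p \<in> frontier (\<Omega> e). Curv (\<Omega> e) p = 0} = 2"
proof -
  obtain p0 where p0: "p0 \<in> {L0<..<L1} \<times> {1/2..2}" "u e p0 = 0" "inflection e p0 = 0"
    "\<And>q. q \<in> {L0..L1} \<times> {1/2..2} \<Longrightarrow> u e q = 0 \<Longrightarrow> inflection e q = 0 \<Longrightarrow> q = p0"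
    using unique_inflection by metis
  obtain x0 y0 where xy: "p0 = (x0, y0)" by fastforce
  have x0: "L0 < x0" "x0 < L1" and y0: "1 / 2 \<le> y0" "y0 \<le> 2" using p0(1) by (auto simp: xy)
  have "{p \<in> frontier (\<Omega> e). Curv (\<Omega> e) p = 0} = {(x0, y0), (- x0, y0)}"
  proof (intro equalityI subsetI)
    fix p assume "p \<in> {p \<in> frontier (\<Omega> e). Curv (\<Omega> e) p = 0}"
    then have p: "p \<in> frontier (\<Omega> e)" "inflection e p = 0" using Curv_sign(3)[of p] by simp_all
    obtain x y where pxy: "p = (x, y)" by fastforce
    have x: "\<bar>x\<bar> < L1" using far_inflection_pos[OF p(1)] p(2) by (force simp: pxy)
    have y: "y \<ge> 1 / 2" "y \<le> 2"
      using near_boundary[OF p(1)] bottom_inflection_pos[OF p(1)] p(2) x by (force simp: pxy)+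
    have "\<bar>x\<bar> > L0" using top_inflection_neg[OF p(1)] p(2) y by (force simp: pxy)
    moreover have "u e (\<bar>x\<bar>, y) = 0" "inflection e (\<bar>x\<bar>, y) = 0"
      using p reflect_x[of e x y] by (auto simp: pxy abs_if frontier_\<Omega>)
    ultimately have "(\<bar>x\<bar>, y) = p0" using p0(4)[of "(\<bar>x\<bar>, y)"] x y by simp
    then show "p \<in> {(x0, y0), (- x0, y0)}" by (auto simp: xy pxy abs_if split: if_splits)
  next
    fix p assume "p \<in> {(x0, y0), (- x0, y0)}"
    then have "u e p = 0" "inflection e p = 0" "p \<in> {-L1..L1} \<times> {1/2..2}"
      using p0(2,3) x0 y0 L0 reflect_x[of e x0 y0] by (auto simp: xy)
    then show "p \<in> {p \<in> frontier (\<Omega> e). Curv (\<Omega> e) p = 0}"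
      using frontier_iff_top[of p] Curv_sign(3)[of p] by simp
  qed
  moreover have "(x0, y0) \<noteq> (- x0, y0)" using x0 L0 by auto
  ultimately show ?thesis by simp
qed

lemma curvature_changes_sign:
  "\<exists>p\<in>frontier (\<Omega> e). Curv (\<Omega> e) p > 0" "\<exists>p\<in>frontier (\<Omega> e). Curv (\<Omega> e) p < 0"
proof -
  have 0: "\<bar>0 :: real\<bar> \<le> L1" using L1 by simp
  obtain y where y: "y \<in> {1/2..2}" "u e (0, y) = 0" using boundary_point_above[OF 0, of 1] by auto
  then have "(0, y) \<in> frontier (\<Omega> e)" using frontier_iff_top[of "(0, y)"] 0 by auto
  then show "\<exists>p\<in>frontier (\<Omega> e). Curv (\<Omega> e) p < 0"
    using top_inflection_neg[of "(0, y)"] Curv_sign(2)[of "(0, y)"] y L0 by force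
  obtain y where y: "y \<in> {1/2..2}" "u e (0, - y) = 0" using boundary_point_above[OF 0, of "- 1"] by auto
  then have "(0, - y) \<in> frontier (\<Omega> e)"
    using nonneg_bounds(3)[of "(0, - y)"] by (auto simp: frontier_\<Omega>)
  then show "\<exists>p\<in>frontier (\<Omega> e). Curv (\<Omega> e) p > 0"
    using bottom_inflection_pos[of "(0, - y)"] Curv_sign(1)[of "(0, - y)"] y L1 by force
qed

section \<open>Minimum of the curvature\<close>

text \<open>Negative values occur only over the central interval, where the bounds by
  \<open>M\<close> apply. The constant is 384 = 6 * 4^3: the numerator is at least -6 M e and the
  gradient has length at least 1/4.\<close>

lemma Curv_lower_bound:
  assumes p: "p \<in> frontier (\<Omega> e)"
  shows "Curv (\<Omega> e) p \<ge> - (384 * M) * e"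
proof (cases "inflection e p < 0")
  case False
  then have "Curv (\<Omega> e) p \<ge> 0" using Curv_sign(2)[OF p] by linarith
  moreover have "- (384 * M) * e \<le> 0" using M(1) e by simp
  ultimately show ?thesis by linarith
next
  case True
  then have x: "\<bar>fst p\<bar> \<le> L1" using far_inflection_pos[OF p] by force
  note B = near_boundary(1)[OF p x]
  have y: "\<bar>snd p\<bar> \<ge> 1 / 2" by (rule near_boundary(2)[OF p x])
  have "\<bar>inflection0 p\<bar> \<le> M" "\<bar>vy p\<bar> \<le> M" by (rule M(2)[OF _ B]; simp add: coefficients_def)+
  then have 1: "inflection e p \<ge> - (6 * M)" and "\<bar>e * vy p\<bar> \<le> e * M"
    using inflection_perturbation[OF B] eM M(1) e by (auto simp: abs_mult)
  then have "\<bar>uy e p\<bar> \<ge> 1 / 4" using y eM unfolding uy_def by linarith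
  also have "\<bar>uy e p\<bar> \<le> norm (ux e p, uy e p)" using norm_snd_le[of "uy e p" "ux e p"] by simp
  finally have n: "norm (ux e p, uy e p) ^ 3 \<ge> (1 / 4) ^ 3" by (intro power_mono) auto
  then have n0: "norm (ux e p, uy e p) ^ 3 > 0" by (simp add: power3_eq_cube)
  have "- (384 * M) * e * norm (ux e p, uy e p) ^ 3 \<le> - (384 * M) * e * (1 / 4) ^ 3"
    using n M(1) e by (intro mult_left_mono_neg) auto
  also have "\<dots> = e * - (6 * M)" by (simp add: power3_eq_cube)
  also have "\<dots> \<le> e * inflection e p" using 1 e by (intro mult_left_mono) auto
  finally show ?thesis unfolding Curv_inflection[OF p] using n0 by (simp add: pos_le_divide_eq)
qed

lemma min_curvature:
  "\<exists>c\<in>Curv (\<Omega> e) ` frontier (\<Omega> e). (\<forall>p\<in>frontier (\<Omega> e). c \<le> Curv (\<Omega> e) p) \<and>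
     - (384 * M) * e \<le> c \<and> c \<le> 0"
proof -
  have "compact (frontier (\<Omega> e))"
    using bounded_\<Omega> by (rule compact_frontier_bounded)
  moreover have "frontier (\<Omega> e) \<noteq> {}" using curvature_changes_sign by blast
  moreover have "continuous_on (frontier (\<Omega> e)) (Curv (\<Omega> e))"
  proof -
    have "continuous_on (frontier (\<Omega> e)) (\<lambda>p. e * inflection e p / norm (ux e p, uy e p) ^ 3)"
      using norm_gradient_pos
      by (intro continuous_intros analytic_expr_continuous analytic_expr_inflection_e analytic_expr_u) force
    then show ?thesis by (rule continuous_on_eq) (simp add: Curv_inflection)
  qed
  ultimately have "\<exists>q\<in>frontier (\<Omega> e). \<forall>p\<in>frontier (\<Omega> e). Curv (\<Omega> e) q \<le> Curv (\<Omega> e) p"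
    by (rule continuous_attains_inf)
  then obtain q where q: "q \<in> frontier (\<Omega> e)" "\<forall>p\<in>frontier (\<Omega> e). Curv (\<Omega> e) q \<le> Curv (\<Omega> e) p" ..
  obtain p where "p \<in> frontier (\<Omega> e)" "Curv (\<Omega> e) p < 0" using curvature_changes_sign(2) ..
  then have "Curv (\<Omega> e) q \<le> 0" using q(2) by force
  then show ?thesis using q Curv_lower_bound[OF q(1)] by (intro bexI[of _ "Curv (\<Omega> e) q"]) auto
qed

end

section \<open>Choice of the constants and conclusion\<close>

theorem theorem1p1:
  fixes k :: nat
  assumes "k \<ge> 2"
  shows "\<exists>\<epsilon>0>0. \<exists>(\<Omega> :: real \<Rightarrow> (real \<times> real) set) (u :: real \<Rightarrow> real \<times> real \<Rightarrow> real).
    (\<forall>\<epsilon>\<in>{0<..<\<epsilon>0}. domain (\<Omega> \<epsilon>) \<and> bounded (\<Omega> \<epsilon>) \<and> smooth_boundary (\<Omega> \<epsilon>) \<and>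
                    torsion_solution (\<Omega> \<epsilon>) (u \<epsilon>)) \<and>
    (\<forall>\<epsilon>\<in>{0<..<\<epsilon>0}. starlike (\<Omega> \<epsilon>)) \<and>
    (\<forall>\<epsilon>\<in>{0<..<\<epsilon>0}.
       (\<exists>c. {p\<in>\<Omega> \<epsilon>. u \<epsilon> p > c} \<noteq> {} \<and> at_least k (components {p\<in>\<Omega> \<epsilon>. u \<epsilon> p > c})) \<and>
       at_least k (max_points (\<Omega> \<epsilon>) (u \<epsilon>))) \<and>
    (\<forall>Q. compact Q \<longrightarrow>
       (\<forall>\<delta>\<in>{0<..<1}. \<forall>\<^sub>F \<epsilon> in at_right 0.
          {(x, y). \<bar>y\<bar> < 1 - \<delta>} \<inter> Q \<subseteq> \<Omega> \<epsilon> \<inter> Q \<and>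
          \<Omega> \<epsilon> \<inter> Q \<subseteq> {(x, y). \<bar>y\<bar> < 1 + \<delta>} \<inter> Q)) \<and>
    (\<forall>\<epsilon>\<in>{0<..<\<epsilon>0}.
       (\<exists>p\<in>frontier (\<Omega> \<epsilon>). Curv (\<Omega> \<epsilon>) p > 0) \<and>
       (\<exists>p\<in>frontier (\<Omega> \<epsilon>). Curv (\<Omega> \<epsilon>) p < 0) \<and>
       card {p\<in>frontier (\<Omega> \<epsilon>). Curv (\<Omega> \<epsilon>) p = 0} = 2) \<and>
    (\<exists>m :: real \<Rightarrow> real.
       (\<forall>\<epsilon>\<in>{0<..<\<epsilon>0}. m \<epsilon> \<in> Curv (\<Omega> \<epsilon>) ` frontier (\<Omega> \<epsilon>) \<and>
                       (\<forall>p\<in>frontier (\<Omega> \<epsilon>). m \<epsilon> \<le> Curv (\<Omega> \<epsilon>) p)) \<and>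
       (m \<longlongrightarrow> 0) (at_right 0))"
proof -
  define a where "a = 1 / (2 * pi * k) ^ 4"
  have a: "a > 0" using assms by (simp add: a_def)
  \<comment> \<open>From here on the slope 24 a x of the quartic part of v_yy beats that of the
    cosine part, whatever \<open>m\<close> is.\<close>
  define L0 where "L0 = (cosh 2 + 2) / (24 * a)"
  define m where "m = cosh 2 + 12 * a * L0\<^sup>2 + 48 * a + 1"
  have m: "m > 0" using a by (auto simp: m_def intro!: add_nonneg_pos add_nonneg_nonneg)
  define W where "W = cosh 2 + 48 * a + 12 * m"
  have W: "W > 0" using a m by (simp add: W_def add_pos_pos)
  \<comment> \<open>The three summands give L1 >= L0, L1 >= 1 and L1 >= W / (6 a); the last two
    yield 6 a L1^2 >= W.\<close>
  define L1 where "L1 = L0 + 1 + W / (6 * a)"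
  have L0: "L0 > 0" "24 * a * L0 \<ge> cosh 2 + 2"
    using a by (auto simp: L0_def intro!: divide_pos_pos add_pos_pos)
  have m_large: "3 * m \<ge> cosh 2 + 12 * a * L0\<^sup>2 + 1" "3 * m \<ge> cosh 2 + 48 * a + 1"
  proof -
    have "cosh (2::real) > 0" "12 * a * L0\<^sup>2 \<ge> 0" using a by simp_all
    then show "3 * m \<ge> cosh 2 + 12 * a * L0\<^sup>2 + 1" "3 * m \<ge> cosh 2 + 48 * a + 1"
      using a by (auto simp: m_def)
  qed
  have WL: "W / (6 * a) > 0" using W a by simp
  have L1: "L1 \<ge> L0" "L1 \<ge> 1" using L0(1) WL by (auto simp: L1_def)
  have L1_sq: "6 * a * L1\<^sup>2 \<ge> W"
  proof -
    have "W / (6 * a) \<le> L1 * 1" using L0(1) by (simp add: L1_def)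
    also have "\<dots> \<le> L1 * L1" using L1(2) by (intro mult_left_mono) auto
    finally show ?thesis using a by (simp add: power2_eq_square field_simps)
  qed
  interpret bumps a m by standard (fact a m)+
  obtain K where K: "K > 0" "\<And>p. \<bar>snd p\<bar> \<le> 2 \<Longrightarrow> v p \<le> K - a / 2 * fst p ^ 4"
    "\<And>p. \<bar>snd p\<bar> \<le> 2 \<Longrightarrow> fst p * vx p + snd p * vy p \<le> 2 * v p + K"
    using v_bounds by metis
  have box: "compact ({-L1..L1} \<times> {-2..2::real})" "convex ({-L1..L1} \<times> {-2..2::real})"
    by (intro compact_Times convex_Times compact_Icc convex_closed_interval convex_real_interval)+
  obtain M where "M \<ge> 1" and M: "\<forall>f\<in>coefficients. \<forall>p\<in>{-L1..L1} \<times> {-2..2}. \<bar>f p\<bar> \<le> M \<and>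
      (\<forall>q\<in>{-L1..L1} \<times> {-2..2}. \<bar>f p - f q\<bar> \<le> M * (\<bar>fst p - fst q\<bar> + \<bar>snd p - snd q\<bar>))"
    using analytic_expr_uniform_bound[OF coefficients_analytic box] by blast
  define T1 T2 D where "T1 = (cosh 2 + 48 * a + 6 * m)\<^sup>2" and "T2 = (cosh 2 + 12 * a + 12 * m)\<^sup>2"
    and "D = ((12 * a + 3 * m) * (2 * pi * k)\<^sup>2 + 4 * m)\<^sup>2"
  \<comment> \<open>Each smallness condition on \<open>e\<close> bounds e times one of these
    nonnegative summands; adding them all makes 1 / N a common threshold.\<close>
  define N where "N = 1 + 4 * K + D + 64 * M\<^sup>2 + T1 / a + 8 * T2 / a"
  have parts: "4 * K \<ge> 0" "D \<ge> 0" "64 * M\<^sup>2 \<ge> 0" "T1 / a \<ge> 0" "8 * T2 / a \<ge> 0"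
    using K a by (simp_all add: T1_def T2_def D_def)
  then have N: "N > 0" unfolding N_def by linarith
  define \<epsilon>0 where "\<epsilon>0 = 1 / N"
  have \<epsilon>0: "\<epsilon>0 > 0" using N by (simp add: \<epsilon>0_def)
  have small: "e * c \<le> 1" if e: "e \<in> {0<..<\<epsilon>0}" and c: "c \<le> N" for e c
  proof -
    have "e * c \<le> e * N" using e c by (intro mult_left_mono) auto
    also have "\<dots> \<le> 1" using e N by (simp add: \<epsilon>0_def field_simps)
    finally show ?thesis .
  qed
  have inflections: "two_inflections a m K e L0 L1 M" and e_components: "e * D \<le> 2"
    if e: "e \<in> {0<..<\<epsilon>0}" for e
  proof -
    have c: "e * (4 * K) \<le> 1" "e * D \<le> 1" "e * (64 * M\<^sup>2) \<le> 1" "e * (T1 / a) \<le> 1"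
      "e * (8 * T2 / a) \<le> 1" "e * 1 \<le> 1"
      by (rule small[OF e], use parts in \<open>unfold N_def, linarith\<close>)+
    then show "e * D \<le> 2" by simp
    have T: "2 * e * T1 < 6 * a" "8 * e * T2 \<le> a" using c a by (simp_all add: field_simps)
    show "two_inflections a m K e L0 L1 M"
    proof
      show "\<bar>f p\<bar> \<le> M" if "f \<in> coefficients" "p \<in> {-L1..L1} \<times> {-2..2}" for f p
        using M that by blast
      show "\<bar>f p - f q\<bar> \<le> M * (\<bar>fst p - fst q\<bar> + \<bar>snd p - snd q\<bar>)"
        if "f \<in> coefficients" "p \<in> {-L1..L1} \<times> {-2..2}" "q \<in> {-L1..L1} \<times> {-2..2}" for f p q
        using M that by blast
      show "6 * a * L1\<^sup>2 \<ge> cosh 2 + 48 * a + 12 * m" using L1_sq by (simp add: W_def)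
      show "2 * e * (cosh 2 + 48 * a + 6 * m)\<^sup>2 < 6 * a" "8 * e * (cosh 2 + 12 * a + 12 * m)\<^sup>2 \<le> a"
        using T by (simp_all add: T1_def T2_def)
      show "e > 0" "e * K \<le> 1 / 4" "e \<le> 1" "64 * e * M\<^sup>2 \<le> 1" using e c by auto
    qed (fact K L0 m_large L1 \<open>M \<ge> 1\<close>)+
  qed
  note strip = two_inflections.axioms(1)[OF inflections]
  have "\<forall>e\<in>{0<..<\<epsilon>0}. \<exists>c. c \<in> Curv (\<Omega> e) ` frontier (\<Omega> e) \<and>
      (\<forall>p\<in>frontier (\<Omega> e). c \<le> Curv (\<Omega> e) p) \<and> - (384 * M) * e \<le> c \<and> c \<le> 0"
    using two_inflections.min_curvature[OF inflections] by blast
  from bchoice[OF this] obtain \<mu> where \<mu>: "\<forall>e\<in>{0<..<\<epsilon>0}. \<mu> e \<in> Curv (\<Omega> e) ` frontier (\<Omega> e) \<and>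
      (\<forall>p\<in>frontier (\<Omega> e). \<mu> e \<le> Curv (\<Omega> e) p) \<and> - (384 * M) * e \<le> \<mu> e \<and> \<mu> e \<le> 0"
    ..
  have \<mu>_lim: "(\<mu> \<longlongrightarrow> 0) (at_right 0)"
  proof (rule tendsto_sandwich)
    show "\<forall>\<^sub>F e in at_right 0. - (384 * M) * e \<le> \<mu> e" "\<forall>\<^sub>F e in at_right 0. \<mu> e \<le> 0"
      by (rule eventually_at_rightI[OF _ \<epsilon>0]; use \<mu> in blast)+
    have "((\<lambda>e. - (384 * M) * e) \<longlongrightarrow> - (384 * M) * 0) (at_right 0)"
      by (intro tendsto_intros)
    then show "((\<lambda>e. - (384 * M) * e) \<longlongrightarrow> 0) (at_right 0)" by simp
  qed simp
  have conv: "\<forall>\<^sub>F e in at_right 0.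
      {(x, y). \<bar>y\<bar> < 1 - \<delta>} \<inter> Q \<subseteq> \<Omega> e \<inter> Q \<and> \<Omega> e \<inter> Q \<subseteq> {(x, y). \<bar>y\<bar> < 1 + \<delta>} \<inter> Q"
    if Q: "compact Q" and \<delta>: "\<delta> \<in> {0<..<1}" for Q \<delta>
  proof -
    obtain C where C: "C > 0" "\<forall>p\<in>Q. \<bar>v p\<bar> \<le> C"
      using analytic_expr_bounded[OF analytic_expr_v(1) Q] by blast
    \<comment> \<open>Only this threshold depends on \<open>Q\<close>, through the bound
      \<open>C\<close> on v, and on \<open>\<delta>\<close>; the family itself is already
      fixed.\<close>
    define b where "b = min \<epsilon>0 (min (\<delta> / K) (\<delta> / (2 * C)))"
    have b: "b > 0" using \<epsilon>0 K(1) C(1) \<delta> by (simp add: b_def)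
    show ?thesis
    proof (rule eventually_at_rightI[OF _ b])
      fix e assume "e \<in> {0<..<b}"
      then have e: "e \<in> {0<..<\<epsilon>0}" "e * K < \<delta>" "e * C < \<delta> / 2"
        using K(1) C(1) by (auto simp: b_def field_simps)
      have "p \<in> \<Omega> e" if "p \<in> Q" "\<bar>snd p\<bar> < 1 - \<delta>" for p
        using perturbed_strip.strip_subset_\<Omega>[OF strip[OF e(1)] _ _ _ e(3) that(2)] C(2) that(1) \<delta> by simp
      moreover have "\<bar>snd p\<bar> < 1 + \<delta>" if "p \<in> \<Omega> e" for p
        by (rule perturbed_strip.\<Omega>_subset_strip[OF strip[OF e(1)] e(2) that])
      ultimately show "{(x, y). \<bar>y\<bar> < 1 - \<delta>} \<inter> Q \<subseteq> \<Omega> e \<inter> Q \<and> \<Omega> e \<inter> Q \<subseteq> {(x, y). \<bar>y\<bar> < 1 + \<delta>} \<inter> Q"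
        by fastforce
    qed
  qed
  have "k > 0" using assms by simp
  note peaks = this a_def e_components[unfolded D_def]
  have "\<forall>e\<in>{0<..<\<epsilon>0}. domain (\<Omega> e) \<and> bounded (\<Omega> e) \<and> smooth_boundary (\<Omega> e) \<and>
      torsion_solution (\<Omega> e) (u e)"
    using strip perturbed_strip.domain_\<Omega> perturbed_strip.bounded_\<Omega>
      perturbed_strip.smooth_boundary_\<Omega> perturbed_strip.torsion_solution_u by blast
  moreover have "\<forall>e\<in>{0<..<\<epsilon>0}. starlike (\<Omega> e)"
    using strip perturbed_strip.starlike_\<Omega> by blast
  moreover have "\<forall>e\<in>{0<..<\<epsilon>0}.
      (\<exists>c. {p\<in>\<Omega> e. u e p > c} \<noteq> {} \<and> at_least k (components {p\<in>\<Omega> e. u e p > c})) \<and>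
      at_least k (max_points (\<Omega> e) (u e))"
  proof (intro ballI conjI exI[of _ "1 / 2"])
    fix e assume e: "e \<in> {0<..<\<epsilon>0}"
    note s = strip[OF e] and ps = peaks(1,2) peaks(3)[OF e]
    show "{p\<in>\<Omega> e. u e p > 1 / 2} \<noteq> {}" by (rule perturbed_strip.superlevel_nonempty[OF s ps])
    show "at_least k (components {p\<in>\<Omega> e. u e p > 1 / 2})"
      by (rule perturbed_strip.at_least_components[OF s ps])
    show "at_least k (max_points (\<Omega> e) (u e))" by (rule perturbed_strip.at_least_max_points[OF s ps])
  qed
  moreover have "\<forall>Q. compact Q \<longrightarrow> (\<forall>\<delta>\<in>{0<..<1}. \<forall>\<^sub>F e in at_right 0.
      {(x, y). \<bar>y\<bar> < 1 - \<delta>} \<inter> Q \<subseteq> \<Omega> e \<inter> Q \<and> \<Omega> e \<inter> Q \<subseteq> {(x, y). \<bar>y\<bar> < 1 + \<delta>} \<inter> Q)"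
    using conv by blast
  moreover have "\<forall>e\<in>{0<..<\<epsilon>0}. (\<exists>p\<in>frontier (\<Omega> e). Curv (\<Omega> e) p > 0) \<and>
      (\<exists>p\<in>frontier (\<Omega> e). Curv (\<Omega> e) p < 0) \<and> card {p\<in>frontier (\<Omega> e). Curv (\<Omega> e) p = 0} = 2"
    by (intro ballI conjI two_inflections.curvature_changes_sign[OF inflections]
        two_inflections.card_zero_curvature[OF inflections])
  moreover have "\<exists>\<mu>. (\<forall>e\<in>{0<..<\<epsilon>0}. \<mu> e \<in> Curv (\<Omega> e) ` frontier (\<Omega> e) \<and>
      (\<forall>p\<in>frontier (\<Omega> e). \<mu> e \<le> Curv (\<Omega> e) p)) \<and> (\<mu> \<longlongrightarrow> 0) (at_right 0)"
    using \<mu> \<mu>_lim by blast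
  ultimately show ?thesis
    using \<epsilon>0 by (intro exI[of _ \<epsilon>0] exI[of _ \<Omega>] exI[of _ u] conjI)
qed

end
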